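(* Let $k\ge 2$ be an integer. If a graph $G$ has rank-width larger than $k$ but all of its proper pivot-minors have rank-width at most $k$, then $$|V(G)|\le \frac{(7/12)\cdot 6^{k+1}-1}{5}.$$
   Context: All graphs are finite and simple. For a graph $G$ and $X\subseteq V(G)$, the cut-rank $\rho_G(X)$ is the rank over $\mathrm{GF}(2)$ of the $X\times(V(G)-X)$ submatrix of the adjacency matrix of $G$. Pivoting an edge $vw$ of $G$ produces the graph $G\wedge vw$ as follows: let $S_1=N(v)-N(w)-\{w\}$, $S_2=N(w)-N(v)-\{v\}$, $S_3=N(v)\cap N(w)$; for every pair $x,y$ of vertices lying in two different sets among $S_1,S_2,S_3$, toggle the adjacency of $x$ and $y$; then swap the labels of $v$ and $w$. A graph is pivot-equivalent to $G$ if it is obtained from $G$ by a sequence of pivots. A graph $H$ is a pivot-minor of $G$ if $H$ is an induced subgraph of a graph pivot-equivalent to $G$; it is proper if $|V(H)|<|V(G)|$. A tree is subcubic if every vertex has degree $1$ or $3$. A rank-decomposition of $G$ is a pair $(T,\mu)$ of a subcubic tree $T$ and a bijection $\mu$ from $V(G)$ to the set of leaves of $T$. For an edge $e$ of $T$, let $C_e$ be a component of $T\setminus e$ and $A_e=\{v\in V(G):\mu(v)\in V(C_e)\}$; the width of $e$ is $\rho_G(A_e)$ (independent of the choice of component). The width of $(T,\mu)$ is the maximum width of an edge of $T$, and the rank-width of $G$ is the minimum width over all rank-decompositions of $G$. Graphs with at most one vertex have rank-width $0$. *)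

theory Defs
  imports
    Complex_Main
    "HOL-Library.Z2"
    "HOL-Library.Function_Algebras"
    "HOL-Combinatorics.Transposition"
    "Graph_Theory.Graph_Theory"
begin

(* A finite simple graph is a pair_graph: a finite, loop-free digraph without parallel arcs whose
   arc relation is symmetric. An edge uv is the pair of arcs (u,v), (v,u). *)

section \<open>Cut-rank\<close>

(* GF(2) is the type bit. *)
global_interpretation gf2: vector_space "\<lambda>(c::bit) (f::'a \<Rightarrow> bit) y. c * f y"
  by unfold_locales
    (simp_all only: fun_eq_iff plus_fun_def distrib_left distrib_right mult.assoc mult_1_left simp_thms)

(* Row x of the X \<times> (V(G) - X) submatrix, extended by 0 outside the column set V(G) - X. *)
definition cut_row :: "'a pair_pre_digraph \<Rightarrow> 'a set \<Rightarrow> 'a \<Rightarrow> ('a \<Rightarrow> bit)" where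
  "cut_row G X x = (\<lambda>y. if y \<in> pverts G - X \<and> (x, y) \<in> parcs G then 1 else 0)"

(* Rank as the dimension of the row space. *)
definition cut_rank :: "'a pair_pre_digraph \<Rightarrow> 'a set \<Rightarrow> nat" where
  "cut_rank G X = gf2.dim (cut_row G X ` X)"

section \<open>Pivot-minors\<close>

definition nbhd :: "'a pair_pre_digraph \<Rightarrow> 'a \<Rightarrow> 'a set" where
  "nbhd G v = {u. (v, u) \<in> parcs G}"

definition pivot :: "'a pair_pre_digraph \<Rightarrow> 'a \<Rightarrow> 'a \<Rightarrow> 'a pair_pre_digraph" where
  "pivot G v w =
    (let S1 = nbhd G v - nbhd G w - {w};
         S2 = nbhd G w - nbhd G v - {v};
         S3 = nbhd G v \<inter> nbhd G w;
         P = S1 \<times> S2 \<union> S1 \<times> S3 \<union> S2 \<times> S3;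
         swap = Transposition.transpose v w
     in \<lparr> pverts = pverts G,
          parcs = map_prod swap swap ` sym_diff (parcs G) (P \<union> P\<inverse>) \<rparr>)"

definition pivot_step :: "'a pair_pre_digraph \<Rightarrow> 'a pair_pre_digraph \<Rightarrow> bool" where
  "pivot_step G H \<longleftrightarrow> (\<exists>v w. (v, w) \<in> parcs G \<and> H = pivot G v w)"

definition pivot_equivalent :: "'a pair_pre_digraph \<Rightarrow> 'a pair_pre_digraph \<Rightarrow> bool" where
  "pivot_equivalent H G \<longleftrightarrow> pivot_step\<^sup>*\<^sup>* G H"

definition pivot_minor :: "'a pair_pre_digraph \<Rightarrow> 'a pair_pre_digraph \<Rightarrow> bool" where
  "pivot_minor H G \<longleftrightarrow> (\<exists>K. pivot_equivalent K G \<and> induced_subgraph H K)"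

definition proper_pivot_minor :: "'a pair_pre_digraph \<Rightarrow> 'a pair_pre_digraph \<Rightarrow> bool" where
  "proper_pivot_minor H G \<longleftrightarrow> pivot_minor H G \<and> card (pverts H) < card (pverts G)"

section \<open>Rank-width\<close>

(* The library's constant tree forbids directed cycles, so no symmetric digraph with an arc
   satisfies it: (u,v), (v,u) is a cycle of length 2. The cycles of the undirected graph are the
   directed cycles of length at least 3. *)
definition undirected_tree :: "'t pair_pre_digraph \<Rightarrow> bool" where
  "undirected_tree T \<longleftrightarrow>
    pair_graph T \<and> connected T \<and> \<not> (\<exists>p. pre_digraph.cycle T p \<and> length p \<ge> 3)"

(* In a symmetric digraph the out-degree is the degree of the undirected graph. *)
definition subcubic_tree :: "'t pair_pre_digraph \<Rightarrow> bool" where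
  "subcubic_tree T \<longleftrightarrow>
    undirected_tree T \<and> (\<forall>x \<in> pverts T. out_degree T x = 1 \<or> out_degree T x = 3)"

definition leaves :: "'t pair_pre_digraph \<Rightarrow> 't set" where
  "leaves T = {x \<in> pverts T. out_degree T x = 1}"

definition rank_decomposition ::
  "'a pair_pre_digraph \<Rightarrow> 't pair_pre_digraph \<Rightarrow> ('a \<Rightarrow> 't) \<Rightarrow> bool" where
  "rank_decomposition G T \<mu> \<longleftrightarrow> subcubic_tree T \<and> bij_betw \<mu> (pverts G) (leaves T)"

definition del_edge :: "'t pair_pre_digraph \<Rightarrow> 't \<times> 't \<Rightarrow> 't pair_pre_digraph" where
  "del_edge T e = \<lparr> pverts = pverts T, parcs = parcs T - {e, prod.swap e} \<rparr>"

(* The component used is the one containing fst e. As both arcs of an edge occur in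
   decomposition_width, the choice of the component does not matter there. *)
definition edge_width ::
  "'a pair_pre_digraph \<Rightarrow> 't pair_pre_digraph \<Rightarrow> ('a \<Rightarrow> 't) \<Rightarrow> 't \<times> 't \<Rightarrow> nat" where
  "edge_width G T \<mu> e =
    cut_rank G {v \<in> pverts G. \<mu> v \<in> pre_digraph.scc_of (del_edge T e) (fst e)}"

definition decomposition_width ::
  "'a pair_pre_digraph \<Rightarrow> 't pair_pre_digraph \<Rightarrow> ('a \<Rightarrow> 't) \<Rightarrow> nat" where
  "decomposition_width G T \<mu> = Max (edge_width G T \<mu> ` parcs T)"

(* Every finite tree is isomorphic to one with nodes in nat, so trees over nat suffice.
   A graph with at least two vertices has a rank-decomposition, so the minimum exists. *)
definition rank_width :: "'a pair_pre_digraph \<Rightarrow> nat" where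
  "rank_width G =
    (if card (pverts G) \<le> 1 then 0
     else (LEAST r. \<exists>(T :: nat pair_pre_digraph) \<mu>.
             rank_decomposition G T \<mu> \<and> decomposition_width G T \<mu> = r))"

end

theory Submission
  imports Defs "HOL-Library.Product_Plus"
begin

text \<open>
  Two things about a graph matter here: its cut-rank function \<rho>, which is symmetric and submodular,
  and the two ways of removing a vertex v by a pivot-minor, namely G - v and (G \<and> vw) - v for a
  neighbour w of v. Write \<rho>1 and \<rho>2 for the cut-rank functions of these two graphs. They cannot
  both be much smaller than \<rho>, because
    \<rho>(X \<inter> Y) + \<rho>(X \<union> Y \<union> {v}) \<le> \<rho>1(X) + \<rho>2(Y) + 1
  whenever v lies in neither X nor Y (reduction_pair_delete_pivot); this is submodularity of the
  rank of submatrices, once the cut-rank after the pivot is recognised as a rank in G itself.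
  The main argument takes place for abstract connectivity functions with such pairs of reductions.

  A decomposition of width at most k is a way of building the ground set by successive disjoint
  unions of sets of width at most k; such sets are called branched below, and rank_width_le_iff
  is the translation.

  Let (A, V - A) be a cut of width m \<le> k. Suppose that some v in A has a reduction \<rho>' for which
  A - {v} is titanic: it cannot be split into three parts that all have width less than m. By
  minimality \<rho>' has a decomposition of width at most k, and it can be rearranged so that V - A hangs
  off a single edge (branched_remove_titanic). On subsets of V - A the functions \<rho> and \<rho>' agree, so
  V - A is branched for \<rho>. If both sides of a cut had such a vertex, the two halves would combine to
  a decomposition of G of width at most k. Hence a cut of width m \<le> k has a small side: one with at
  most cut_bound m elements.

  The value of cut_bound is found by induction on m. One of the two reductions at v at most doubles
  the bound on the small sides of cuts of width less than m (reduction_small_cuts), so A - {v} is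
  titanic in it as soon as one of any three parts is larger than the doubled bound. That gives
  cut_bound m = 6 * cut_bound (m - 1) + 1, hence the values 0, 1 and 7 for m = 0, 1, 2. For m = 2
  the value 7 can be lowered to 4, and this accounts for the factor 7 / 12 in the theorem: if A has
  at least five elements, then v can be chosen more carefully
  (titanic_of_rank_two_cut). If deleting some u from A does not increase the width of A, then one
  of the reductions at u leaves all widths inside A - {u} unchanged, and A - {u} is titanic because
  every set of two or more elements has width at least 2. Otherwise every v works: two bad
  partitions of A - {v}, one for each reduction, consist of parts that overlap pairwise in exactly
  one element, and uniting suitable parts with {v} produces a set A - {u} of width at most 2.

  Finally, if G had more than 6 * cut_bound k + 1 vertices, then a reduction of G would have a
  cut of width at most k with more than 2 * cut_bound k elements on both sides, because every
  decomposition displays a cut that leaves at least a third on either side. This contradicts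
  reduction_small_cuts.
\<close>

section \<open>Connectivity functions and branched sets\<close>

locale connectivity =
  fixes V :: "'a set" and f :: "'a set \<Rightarrow> nat"
  assumes finite_ground: "finite V"
    and empty: "f {} = 0"
    and symmetric: "X \<subseteq> V \<Longrightarrow> f (V - X) = f X"
    and submodular: "X \<subseteq> V \<Longrightarrow> Y \<subseteq> V \<Longrightarrow> f (X \<union> Y) + f (X \<inter> Y) \<le> f X + f Y"
begin

lemma ground: "f V = 0"
  using symmetric[of "{}"] empty by simp

lemma posimodular:
  assumes "X \<subseteq> V" "Y \<subseteq> V"
  shows "f (X - Y) + f (Y - X) \<le> f X + f Y"
proof -
  have "f (X \<union> (V - Y)) + f (X \<inter> (V - Y)) \<le> f X + f (V - Y)"
    using assms by (intro submodular) auto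
  moreover have "X \<union> (V - Y) = V - (Y - X)" "X \<inter> (V - Y) = X - Y"
    using assms by auto
  moreover have "f (V - (Y - X)) = f (Y - X)" "f (V - Y) = f Y"
    using assms by (intro symmetric; auto)+
  ultimately show ?thesis by simp
qed

end

text \<open>
  The subsets of the ground set that occur in a rooted binary decomposition of width at most k.
  A rank-decomposition is such a tree without its root; working with sets avoids trees until the
  translation to graphs.
\<close>

inductive branched :: "('a set \<Rightarrow> nat) \<Rightarrow> nat \<Rightarrow> 'a set \<Rightarrow> bool" for f k where
  leaf: "f {x} \<le> k \<Longrightarrow> branched f k {x}"
| join: "branched f k X \<Longrightarrow> branched f k Y \<Longrightarrow> X \<inter> Y = {} \<Longrightarrow> f (X \<union> Y) \<le> k
    \<Longrightarrow> branched f k (X \<union> Y)"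

lemma branched_le: "branched f k X \<Longrightarrow> f X \<le> k"
  by (induction rule: branched.induct) auto

lemma branched_mono:
  assumes "branched f k X" "\<And>Y. Y \<subseteq> X \<Longrightarrow> g Y \<le> f Y"
  shows "branched g k X"
  using assms
proof (induction rule: branched.induct)
  case (leaf x)
  then show ?case by (meson branched.leaf le_trans order_refl)
next
  case (join X Y)
  have "g (X \<union> Y) \<le> k" using join.hyps join.prems[of "X \<union> Y"] by simp
  moreover have "branched g k X" "branched g k Y"
    using join.IH join.prems by (meson le_supI1 le_supI2)+
  ultimately show ?case using join.hyps(3) by (intro branched.join) auto
qed

lemma branched_bounded:
  assumes "finite S" "S \<noteq> {}" "\<And>X. X \<subseteq> S \<Longrightarrow> f X \<le> k"
  shows "branched f k S"
  using assms
proof (induction rule: finite_ne_induct)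
  case (singleton x)
  then show ?case by (simp add: branched.leaf)
next
  case (insert x F)
  have "branched f k ({x} \<union> F)"
  proof (rule branched.join)
    show "branched f k {x}" "f ({x} \<union> F) \<le> k"
      using insert.prems[of "{x}"] insert.prems[of "{x} \<union> F"] by (simp_all add: branched.leaf)
    show "branched f k F" using insert.prems by (intro insert.IH) (meson subset_insertI2)
  qed (use insert.hyps in auto)
  then show ?case by simp
qed

text \<open>
  Removing a set from a decomposition can make some of its members empty; this is the joining step
  for what is left.
\<close>

lemma branched_join_maybe_empty:
  assumes "X = {} \<or> branched f k X" "Y = {} \<or> branched f k Y"
    "X \<inter> Y = {}" "f (X \<union> Y) \<le> k"
  shows "X \<union> Y = {} \<or> branched f k (X \<union> Y)"
  using assms by (auto intro: branched.join)

text \<open>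
  Parts may be empty; so if the empty set has width 0 and m > 0, then a titanic set has width at
  least m itself.
\<close>

definition titanic :: "('a set \<Rightarrow> nat) \<Rightarrow> nat \<Rightarrow> 'a set \<Rightarrow> bool" where
  "titanic f m A \<longleftrightarrow> (\<forall>P Q R. P \<union> Q \<union> R = A \<longrightarrow> P \<inter> Q = {} \<longrightarrow> P \<inter> R = {} \<longrightarrow> Q \<inter> R = {} \<longrightarrow>
     m \<le> f P \<or> m \<le> f Q \<or> m \<le> f R)"

context connectivity
begin

text \<open>
  The parts need not be disjoint: by posimodularity one of two overlapping parts can give up the
  overlap without an increase of its width.
\<close>

lemma titanic_cover:
  assumes "titanic f m A" "A \<subseteq> V" "P \<union> Q \<union> R = A"
  shows "m \<le> f P \<or> m \<le> f Q \<or> m \<le> f R"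
  using assms(3)
proof (induction "card P + card Q + card R" arbitrary: P Q R rule: less_induct)
  case less
  have finA: "finite A" using assms(2) finite_ground finite_subset by blast
  have uncross: "m \<le> f P' \<or> m \<le> f Q' \<or> m \<le> f R'"
    if c: "card P' + card Q' + card R' = card P + card Q + card R"
      and u: "P' \<union> Q' \<union> R' = A" and ne: "P' \<inter> Q' \<noteq> {}" for P' Q' R'
  proof -
    have fin: "finite P'" "finite Q'" using u finA by (auto intro: finite_subset)
    have "f (P' - Q') + f (Q' - P') \<le> f P' + f Q'"
      using u assms(2) by (intro posimodular) auto
    then consider "f (P' - Q') \<le> f P'" | "f (Q' - P') \<le> f Q'" by linarith
    then show ?thesis
    proof cases
      case 1
      have "card (P' - Q') < card P'" using ne fin by (intro psubset_card_mono) auto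
      then have "m \<le> f (P' - Q') \<or> m \<le> f Q' \<or> m \<le> f R'"
        using c u by (intro less) auto
      then show ?thesis using 1 by linarith
    next
      case 2
      have "card (Q' - P') < card Q'" using ne fin by (intro psubset_card_mono) auto
      then have "m \<le> f P' \<or> m \<le> f (Q' - P') \<or> m \<le> f R'"
        using c u by (intro less) auto
      then show ?thesis using 2 by linarith
    qed
  qed
  consider "P \<inter> Q = {}" "P \<inter> R = {}" "Q \<inter> R = {}" | "P \<inter> Q \<noteq> {}" | "P \<inter> R \<noteq> {}" | "Q \<inter> R \<noteq> {}"
    by blast
  then show ?case
  proof cases
    case 1
    then show ?thesis using assms(1) less.prems unfolding titanic_def by blast
  next
    case 2
    then show ?thesis using uncross[of P Q R] less.prems by simp
  next
    case 3
    then show ?thesis using uncross[of P R Q] less.prems by (auto simp: ac_simps)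
  next
    case 4
    then show ?thesis using uncross[of Q R P] less.prems by (auto simp: ac_simps)
  qed
qed

text \<open>
  The condition that the width of \<open>S \<inter> A\<close> is at least that of A is not monotone in S, which an
  induction along a tree needs. Asking the same of all sets between \<open>S \<inter> A\<close> and A makes it monotone.
\<close>

definition spans :: "'a set \<Rightarrow> 'a set \<Rightarrow> bool" where
  "spans A S \<longleftrightarrow> (\<forall>Z. S \<inter> A \<subseteq> Z \<longrightarrow> Z \<subseteq> A \<longrightarrow> f A \<le> f Z)"

lemma spans_mono: "spans A S \<Longrightarrow> S \<inter> A \<subseteq> T \<Longrightarrow> spans A T"
  unfolding spans_def by blast

text \<open>
  Sets that witness the failure of the three disjuncts cover A but may overlap, so they contradict
  the version of titanic for covers.
\<close>

lemma spans_partition: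
  assumes "titanic f (f A) A" "A \<subseteq> V" "A \<subseteq> P \<union> Q \<union> R"
  shows "spans A P \<or> spans A Q \<or> spans A R"
proof (rule ccontr)
  assume "\<not> ?thesis"
  then obtain P' Q' R' where
    "P \<inter> A \<subseteq> P'" "P' \<subseteq> A" "f P' < f A"
    "Q \<inter> A \<subseteq> Q'" "Q' \<subseteq> A" "f Q' < f A"
    "R \<inter> A \<subseteq> R'" "R' \<subseteq> A" "f R' < f A"
    unfolding spans_def by (meson not_le)
  moreover from this have "P' \<union> Q' \<union> R' = A" using assms(3) by blast
  ultimately show False using titanic_cover[OF assms(1,2), of P' Q' R'] by linarith
qed

lemma spans_remove_le:
  assumes "A \<subseteq> V" "S \<subseteq> V" "spans A (V - S)"
  shows "f (S - A) \<le> f S"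
proof -
  have "f A \<le> f ((V - S) \<inter> A)" using assms(3) unfolding spans_def by blast
  moreover have "f ((V - S) \<union> A) + f ((V - S) \<inter> A) \<le> f (V - S) + f A"
    using assms by (intro submodular) auto
  moreover have "(V - S) \<union> A = V - (S - A)" using assms by auto
  moreover have "f (V - (S - A)) = f (S - A)" "f (V - S) = f S"
    using assms by (intro symmetric; auto)+
  ultimately show ?thesis by simp
qed

text \<open>
  If the part of A outside S already spans A, then A can be removed from every member of the
  decomposition below S: its complement spans A too, by monotonicity.
\<close>

lemma branched_remove:
  assumes "branched f k S" "A \<subseteq> V" "S \<subseteq> V" "spans A (V - S)"
  shows "S - A = {} \<or> branched f k (S - A)"
  using assms
proof (induction rule: branched.induct)
  case (leaf x)
  then show ?case by (cases "x \<in> A") (auto simp: insert_Diff_if intro: branched.leaf)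
next
  case (join X Y)
  have "spans A (V - X)" "spans A (V - Y)"
    using join.prems(3) by (auto elim: spans_mono)
  then have "X - A = {} \<or> branched f k (X - A)" "Y - A = {} \<or> branched f k (Y - A)"
    using join by auto
  moreover have "f ((X \<union> Y) - A) \<le> k"
    using spans_remove_le[of A "X \<union> Y"] join by simp
  ultimately show ?case
    using join.hyps(3) branched_join_maybe_empty[of "X - A" f k "Y - A"]
    by (auto simp: Un_Diff)
qed

text \<open>
  Walk down from the root, always into a member S that spans A. The complement of S without A
  stays branched on the way, since it is assembled from the siblings that are passed. At a
  leaf only this leaf has to be added. If the walk stops earlier, then neither child spans A, so the
  outside does, and the three pieces around this node fit together to V - A.
\<close>

lemma branched_remove_titanic:
  assumes br: "branched f k V" and A: "A \<subseteq> V" "f A \<le> k" and tit: "titanic f (f A) A"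
  shows "V - A = {} \<or> branched f k (V - A)"
proof -
  have "V - A = {} \<or> branched f k (V - A)"
    if "branched f k S" "S \<subseteq> V" "spans A S" "V - S - A = {} \<or> branched f k (V - S - A)" for S
    using that
  proof (induction rule: branched.induct)
    case (leaf x)
    have split: "V - A = (V - {x} - A) \<union> ({x} - A)" using leaf.prems by auto
    have "{x} - A = {} \<or> branched f k ({x} - A)"
      using leaf.hyps by (cases "x \<in> A") (auto simp: insert_Diff_if intro: branched.leaf)
    moreover have "f (V - A) \<le> k" using A by (simp add: symmetric)
    moreover have "(V - {x} - A) \<inter> ({x} - A) = {}" by auto
    ultimately show ?case
      unfolding split using branched_join_maybe_empty leaf.prems(3) split by metis
  next
    case (join X Y)
    have XY: "X \<subseteq> V" "Y \<subseteq> V" using join.prems by auto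
    have part: "V - A = (V - (X \<union> Y) - A) \<union> ((X \<union> Y) - A)" using XY by auto
    have step: ?case if br: "branched f k X'" "branched f k Y'" "X' \<inter> Y' = {}" "X' \<union> Y' = X \<union> Y"
      and sp: "spans A X'" and IH: "spans A X' \<Longrightarrow> V - X' - A = {} \<or> branched f k (V - X' - A) \<Longrightarrow> ?case"
    for X' Y'
    proof (rule IH[OF sp])
      have sub: "X' \<subseteq> V" "Y' \<subseteq> V" using XY br(4) by auto
      have "spans A (V - Y')" using sp br(3) sub by (auto elim!: spans_mono)
      then have "Y' - A = {} \<or> branched f k (Y' - A)"
        using branched_remove br sub A by blast
      moreover have "V - X' - A = (V - (X \<union> Y) - A) \<union> (Y' - A)"
        using br(3,4) sub by auto
      moreover have "(V - (X \<union> Y) - A) \<inter> (Y' - A) = {}" using br(4) by auto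
      moreover have "f (V - X' - A) \<le> k"
      proof -
        have "V - (V - X') = X'" using sub by auto
        then have "f (V - X' - A) \<le> f (V - X')"
          using spans_remove_le[of A "V - X'"] A sp by auto
        also have "\<dots> = f X'" using sub by (simp add: symmetric)
        finally show ?thesis using branched_le[OF br(1)] by simp
      qed
      ultimately show "V - X' - A = {} \<or> branched f k (V - X' - A)"
        using branched_join_maybe_empty join.prems(3) by metis
    qed
    have "A \<subseteq> X \<union> Y \<union> (V - (X \<union> Y))" using A by auto
    then consider "spans A X" | "spans A Y" | "spans A (V - (X \<union> Y))"
      using spans_partition[OF tit A(1)] by blast
    then show ?case
    proof cases
      case 1
      show ?thesis by (rule step[of X Y]) (use 1 join XY in auto)
    next
      case 2
      show ?thesis by (rule step[of Y X]) (use 2 join XY in auto)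
    next
      case 3
      have "branched f k (X \<union> Y)" using join.hyps by (rule branched.join)
      then have "X \<union> Y - A = {} \<or> branched f k (X \<union> Y - A)"
        using branched_remove 3 XY A by blast
      moreover have "f (V - A) \<le> k" using A by (simp add: symmetric)
      moreover have "(V - (X \<union> Y) - A) \<inter> ((X \<union> Y) - A) = {}" by auto
      ultimately show ?thesis using branched_join_maybe_empty join.prems(3) part by metis
    qed
  qed
  moreover have "spans A V" using A by (auto simp: spans_def Int_absorb1)
  ultimately show ?thesis using br by blast
qed

text \<open>
  Descend to a child with more than c elements until the complement has more than c elements as
  well.
\<close>

lemma branched_balanced_cut:
  assumes "branched f k V" "3 * c < card V" "0 < c"
  obtains S where "S \<subseteq> V" "f S \<le> k" "c < card S" "c < card (V - S)"
proof -
  have "\<exists>S. S \<subseteq> V \<and> f S \<le> k \<and> c < card S \<and> c < card (V - S)"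
    if "branched f k S" "S \<subseteq> V" "card (V - S) \<le> c" for S
    using that
  proof (induction rule: branched.induct)
    case (leaf x)
    have "card V = card (V - {x}) + card {x}"
      using leaf.prems finite_ground by (metis card_Diff_subset card_mono finite_subset le_add_diff_inverse2)
    then show ?case using leaf.prems assms by simp
  next
    case (join X Y)
    have fin: "finite X" "finite Y" using join.prems finite_ground by (auto intro: finite_subset)
    have "card V = card (V - (X \<union> Y)) + card (X \<union> Y)"
      using join.prems finite_ground by (metis card_Diff_subset card_mono finite_subset le_add_diff_inverse2)
    also have "card (X \<union> Y) = card X + card Y"
      using fin join.hyps(3) by (rule card_Un_disjoint)
    finally have "c < card X \<or> c < card Y" using join.prems assms by linarith
    moreover have "f X \<le> k" "f Y \<le> k" using join.hyps branched_le by auto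
    ultimately show ?case using join.IH join.prems by (metis Un_subset_iff not_le)
  qed
  then show thesis using that assms(1) by force
qed

end

section \<open>Reductions at an element\<close>

text \<open>
  The properties of the cut-rank function g of a pivot-minor on \<open>V - {v}\<close> in terms of the cut-rank
  function f of the graph. By the last condition, f and g agree on all subsets of Z if they agree
  on Z: it says that passing from f to g loses more on larger sets.
\<close>

definition reduction :: "'a set \<Rightarrow> ('a set \<Rightarrow> nat) \<Rightarrow> 'a \<Rightarrow> ('a set \<Rightarrow> nat) \<Rightarrow> bool" where
  "reduction V f v g \<longleftrightarrow> connectivity (V - {v}) g \<and>
     (\<forall>X \<subseteq> V - {v}. g X \<le> f X) \<and>
     (\<forall>X Z. X \<subseteq> Z \<longrightarrow> Z \<subseteq> V - {v} \<longrightarrow> f X + g Z \<le> g X + f Z)"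

text \<open>
  The inequality limits how much two complementary ways to remove v can lose together. In matroids,
  deletion and contraction of an element satisfy it.
\<close>

definition reduction_pair ::
  "'a set \<Rightarrow> ('a set \<Rightarrow> nat) \<Rightarrow> 'a \<Rightarrow> ('a set \<Rightarrow> nat) \<Rightarrow> ('a set \<Rightarrow> nat) \<Rightarrow> bool" where
  "reduction_pair V f v g h \<longleftrightarrow> reduction V f v g \<and> reduction V f v h \<and>
     (\<forall>X Y. X \<subseteq> V - {v} \<longrightarrow> Y \<subseteq> V - {v} \<longrightarrow>
        f (X \<inter> Y) + f (insert v (X \<union> Y)) \<le> g X + h Y + 1)"

definition small_cuts :: "'a set \<Rightarrow> ('a set \<Rightarrow> nat) \<Rightarrow> nat \<Rightarrow> (nat \<Rightarrow> nat) \<Rightarrow> bool" where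
  "small_cuts V f m s \<longleftrightarrow>
     (\<forall>X \<subseteq> V. f X < m \<longrightarrow> card X \<le> s (f X) \<or> card (V - X) \<le> s (f X))"

lemma reductionD:
  assumes "reduction V f v g"
  shows "connectivity (V - {v}) g"
    and "X \<subseteq> V - {v} \<Longrightarrow> g X \<le> f X"
    and "X \<subseteq> Z \<Longrightarrow> Z \<subseteq> V - {v} \<Longrightarrow> f X + g Z \<le> g X + f Z"
  using assms unfolding reduction_def by auto

lemma reduction_pair_commute:
  assumes "reduction_pair V f v g h"
  shows "reduction_pair V f v h g"
  unfolding reduction_pair_def
proof (intro conjI allI impI)
  fix X Y assume XY: "X \<subseteq> V - {v}" "Y \<subseteq> V - {v}"
  have "f (Y \<inter> X) + f (insert v (Y \<union> X)) \<le> g Y + h X + 1"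
    using assms XY unfolding reduction_pair_def by blast
  then show "f (X \<inter> Y) + f (insert v (X \<union> Y)) \<le> h X + g Y + 1"
    by (simp add: Int_commute Un_commute)
qed (use assms in \<open>auto simp: reduction_pair_def\<close>)

lemma reduction_pairD:
  assumes "reduction_pair V f v g h"
  shows "reduction V f v g" "reduction V f v h"
    and "X \<subseteq> V - {v} \<Longrightarrow> Y \<subseteq> V - {v} \<Longrightarrow> f (X \<inter> Y) + f (insert v (X \<union> Y)) \<le> g X + h Y + 1"
  using assms unfolding reduction_pair_def by auto

context connectivity
begin

text \<open>
  The inequality for a reduction pair in terms of opposite quadrants of two crossing cuts.
\<close>

lemma reduction_pair_crossing:
  assumes "reduction_pair V f v g h" "v \<in> V" "X \<subseteq> V - {v}" "Y \<subseteq> V - {v}"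
  shows "f (X \<inter> Y) + f (V - {v} - X - Y) \<le> g X + h Y + 1"
proof -
  have "insert v (X \<union> Y) = V - (V - {v} - X - Y)" using assms by auto
  then have "f (insert v (X \<union> Y)) = f (V - {v} - X - Y)"
    by (metis Diff_subset double_diff symmetric Diff_subset order_trans)
  then show ?thesis using reduction_pairD(3)[OF assms(1,3,4)] by simp
qed

lemma reduction_eq_below:
  assumes red: "reduction V f v g" and Z: "Z \<subseteq> V - {v}" "f Z \<le> g Z" and "X \<subseteq> Z"
  shows "f X \<le> g X"
  using reductionD(3)[OF red assms(4) Z(1)] Z(2) by linarith

text \<open>
  A decomposition of the reduction is rearranged so as to contain \<open>V - A\<close>. The two functions agree
  on \<open>V - A\<close>, since the titanic set \<open>A - {v}\<close> has the same width as A.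
\<close>

lemma branched_complement_of_reduction:
  assumes red: "reduction V f v g" and br: "branched g k (V - {v})"
    and A: "v \<in> A" "A \<subseteq> V" "A \<noteq> V" "f A \<le> k" and tit: "titanic g (f A) (A - {v})"
  shows "branched f k (V - A)"
proof -
  interpret r: connectivity "V - {v}" g using reductionD(1)[OF red] .
  have sub: "A - {v} \<subseteq> V - {v}" "V - A \<subseteq> V - {v}" using A by auto
  have comp: "V - {v} - (A - {v}) = V - A" using A by auto
  have "f A \<le> g (A - {v}) \<or> f A \<le> g {} \<or> f A \<le> g {}"
    using tit unfolding titanic_def by (metis Int_empty_right Un_empty_right)
  then have ge: "f A \<le> g (A - {v})" using r.empty by auto
  have gB: "g (V - A) = g (A - {v})" using r.symmetric[OF sub(1)] comp by simp
  have fB: "f (V - A) = f A" using A(2) by (rule symmetric)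
  have "g (V - A) \<le> f (V - A)" using reductionD(2)[OF red sub(2)] .
  then have "g (A - {v}) = f A" using gB fB ge by simp
  then have "V - A = {} \<or> branched g k (V - A)"
    using r.branched_remove_titanic[OF br sub(1)] A(4) tit comp by simp
  then have "branched g k (V - A)" using A by blast
  then show ?thesis
    by (rule branched_mono) (use reduction_eq_below[OF red sub(2)] gB fB ge in simp)
qed

text \<open>
  Of each pair of opposite quadrants one is narrow and hence small, because the cuts that bound it
  have large sides. Then two adjacent quadrants are small, so that one of the four sides is small
  after all.
\<close>

lemma crossing_small_cuts:
  assumes pair: "reduction_pair V f v g h" and v: "v \<in> V"
    and small: "small_cuts V f m s" and mono: "mono s"
    and X: "X \<subseteq> V - {v}" "g X < m" "2 * s (g X) < card X" "2 * s (g X) < card (V - {v} - X)"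
    and Y: "Y \<subseteq> V - {v}" "h Y < m" "2 * s (h Y) < card Y" "2 * s (h Y) < card (V - {v} - Y)"
    and le: "h Y \<le> g X"
  shows False
proof -
  interpret g: connectivity "V - {v}" g using reductionD(1)[OF reduction_pairD(1)[OF pair]] .
  interpret h: connectivity "V - {v}" h using reductionD(1)[OF reduction_pairD(2)[OF pair]] .
  let ?a = "s (g X)" and ?b = "s (h Y)"
  have ba: "?b \<le> ?a" using mono le by (auto dest: monoD)
  (* S and T range over both sides of the two cuts, so that all four pairs of opposite quadrants are
     covered at once. *)
  have quad: "card (S \<inter> T) \<le> ?a \<or> card (V - {v} - S - T) \<le> ?b"
    if S: "S = X \<or> S = V - {v} - X" and T: "T = Y \<or> T = V - {v} - Y" for S T
  proof -
    have ST: "S \<subseteq> V - {v}" "T \<subseteq> V - {v}" using S T X Y by auto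
    have eq: "g S = g X" "h T = h Y" using S T g.symmetric h.symmetric X(1) Y(1) by auto
    have cards: "2 * ?a < card (V - {v} - S)" "2 * ?b < card T"
      using S T X Y by (auto simp: double_diff)
    have "f (S \<inter> T) \<le> g X \<or> f (V - {v} - S - T) \<le> h Y"
      using reduction_pair_crossing[OF pair v ST] eq by linarith
    then show ?thesis
    proof
      assume *: "f (S \<inter> T) \<le> g X"
      then have sm: "s (f (S \<inter> T)) \<le> ?a" using mono by (auto dest: monoD)
      have "card (V - {v} - S) \<le> card (V - S \<inter> T)"
        using finite_ground by (intro card_mono) auto
      then have "\<not> card (V - S \<inter> T) \<le> ?a" using cards by linarith
      moreover have "S \<inter> T \<subseteq> V" using ST by auto
      then have "card (S \<inter> T) \<le> s (f (S \<inter> T)) \<or> card (V - S \<inter> T) \<le> s (f (S \<inter> T))"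
        using small X(2) * unfolding small_cuts_def by (meson le_less_trans)
      ultimately show ?thesis using sm by linarith
    next
      let ?C = "V - {v} - S - T"
      assume *: "f ?C \<le> h Y"
      then have sm: "s (f ?C) \<le> ?b" using mono by (auto dest: monoD)
      have "card T \<le> card (V - ?C)"
        using finite_ground ST by (intro card_mono) auto
      then have "\<not> card (V - ?C) \<le> ?b" using cards by linarith
      moreover have "?C \<subseteq> V" by auto
      then have "card ?C \<le> s (f ?C) \<or> card (V - ?C) \<le> s (f ?C)"
        using small Y(2) * unfolding small_cuts_def by (meson le_less_trans)
      ultimately show ?thesis using sm by linarith
    qed
  qed
  let ?W = "V - {v}"
  have split: "card S = card (S \<inter> T) + card (S \<inter> (?W - T))" if "S \<subseteq> ?W" for S T
  proof -
    have "S = (S \<inter> T) \<union> (S \<inter> (?W - T))" "finite S"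
      using that finite_ground by (auto intro: finite_subset)
    then show ?thesis by (metis Diff_disjoint Int_Un_eq(3) Int_assoc card_Un_disjoint finite_Int inf_bot_right inf_commute inf_left_commute)
  qed
  define p q r t where "p = card (X \<inter> Y)" "q = card (X \<inter> (?W - Y))"
    "r = card ((?W - X) \<inter> Y)" "t = card ((?W - X) \<inter> (?W - Y))"
  have "card X = p + q" "card (?W - X) = r + t" "card Y = p + r" "card (?W - Y) = q + t"
    using split[of X Y] split[of "?W - X" Y] split[of Y X] split[of "?W - Y" X] X(1) Y(1)
    unfolding p_q_r_t_def by (auto simp: Int_commute)
  moreover have "?W - X - Y = (?W - X) \<inter> (?W - Y)" "?W - X - (?W - Y) = (?W - X) \<inter> Y"
    "?W - (?W - X) - Y = X \<inter> (?W - Y)" "?W - (?W - X) - (?W - Y) = X \<inter> Y"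
    using X(1) Y(1) by auto
  then have "p \<le> ?a \<or> t \<le> ?b" "q \<le> ?a \<or> r \<le> ?b" "r \<le> ?a \<or> q \<le> ?b" "t \<le> ?a \<or> p \<le> ?b"
    using quad[of X Y] quad[of X "?W - Y"] quad[of "?W - X" Y] quad[of "?W - X" "?W - Y"]
    unfolding p_q_r_t_def by auto
  ultimately show False using X Y ba by linarith
qed

lemma reduction_small_cuts:
  assumes pair: "reduction_pair V f v g h" and v: "v \<in> V"
    and small: "small_cuts V f m s" and mono: "mono s"
  shows "small_cuts (V - {v}) g m (\<lambda>i. 2 * s i) \<or> small_cuts (V - {v}) h m (\<lambda>i. 2 * s i)"
proof (rule ccontr)
  assume "\<not> ?thesis"
  then obtain X Y where
    X: "X \<subseteq> V - {v}" "g X < m" "2 * s (g X) < card X" "2 * s (g X) < card (V - {v} - X)" and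
    Y: "Y \<subseteq> V - {v}" "h Y < m" "2 * s (h Y) < card Y" "2 * s (h Y) < card (V - {v} - Y)"
    unfolding small_cuts_def by (metis not_le)
  show False
  proof (cases "h Y \<le> g X")
    case True
    then show ?thesis using crossing_small_cuts[OF pair v small mono X Y] by simp
  next
    case False
    then show ?thesis
      using crossing_small_cuts[OF reduction_pair_commute[OF pair] v small mono Y X] by simp
  qed
qed

lemma titanic_of_small_cuts:
  assumes red: "reduction V f v g" and small: "small_cuts (V - {v}) g m (\<lambda>i. 2 * s i)"
    and mono: "mono s" and A: "v \<in> A" "A \<subseteq> V" "6 * s (m - 1) + 1 < card A"
    and B: "2 * s (m - 1) < card (V - A)"
  shows "titanic g m (A - {v})"
  unfolding titanic_def
proof (intro allI impI)
  fix P Q R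
  assume U: "P \<union> Q \<union> R = A - {v}" and "P \<inter> Q = {}" "P \<inter> R = {}" "Q \<inter> R = {}"
  have finA: "finite A" using A finite_ground finite_subset by blast
  have fin: "finite P" "finite Q" "finite R" using U finA by (metis finite_Diff finite_Un)+
  have big: "m \<le> g X" if "X \<subseteq> A - {v}" "2 * s (m - 1) < card X" for X
  proof (rule ccontr)
    assume "\<not> m \<le> g X"
    then have lt: "g X < m" "g X \<le> m - 1" by auto
    have le: "s (g X) \<le> s (m - 1)" using mono lt(2) by (rule monoD)
    have "card (V - A) \<le> card (V - {v} - X)" using finite_ground A that by (intro card_mono) auto
    moreover have "card X \<le> 2 * s (g X) \<or> card (V - {v} - X) \<le> 2 * s (g X)"
      using small lt(1) that A unfolding small_cuts_def by blast
    ultimately show False using that B le by linarith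
  qed
  have "card (A - {v}) \<le> card P + card Q + card R"
    unfolding U[symmetric] by (meson add_le_mono1 card_Un_le le_trans)
  moreover have "card (A - {v}) = card A - 1" using A finA by simp
  ultimately have "2 * s (m - 1) < card P \<or> 2 * s (m - 1) < card Q \<or> 2 * s (m - 1) < card R"
    using A(3) by linarith
  then show "m \<le> g P \<or> m \<le> g Q \<or> m \<le> g R" using big U by blast
qed

end

section \<open>Cuts of width two\<close>

context connectivity
begin

text \<open>
  The pair inequality for \<open>X = Y = A - {u}\<close> shows that one of the two reductions keeps the width 2
  of \<open>A - {u}\<close>, and then the widths of all its subsets.
\<close>

lemma titanic_of_lossless_deletion:
  assumes pair: "reduction_pair V f u g h" and A: "u \<in> A" "A \<subseteq> V" "f A = 2" "5 \<le> card A"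
    and prime: "\<And>X. X \<subseteq> A \<Longrightarrow> 2 \<le> card X \<Longrightarrow> 2 \<le> f X"
    and le: "f (A - {u}) \<le> 2"
  shows "titanic g 2 (A - {u}) \<or> titanic h 2 (A - {u})"
proof -
  let ?A = "A - {u}"
  have finA: "finite A" using A finite_ground finite_subset by blast
  have sub: "?A \<subseteq> V - {u}" using A by auto
  have card: "4 \<le> card ?A" using A finA by simp
  have "f (?A \<inter> ?A) + f (insert u (?A \<union> ?A)) \<le> g ?A + h ?A + 1"
    using reduction_pairD(3)[OF pair sub sub] .
  moreover have "insert u (?A \<union> ?A) = A" using A by auto
  moreover have "2 \<le> f ?A" using prime[of ?A] card by auto
  ultimately have "2 \<le> g ?A \<or> 2 \<le> h ?A" using A by auto
  moreover have "titanic e 2 ?A" if red: "reduction V f u e" and "2 \<le> e ?A" for e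
    unfolding titanic_def
  proof (intro allI impI)
    fix P Q R assume U: "P \<union> Q \<union> R = ?A"
    have big: "2 \<le> e X" if "X \<subseteq> ?A" "2 \<le> card X" for X
    proof -
      have "2 \<le> f X" using that by (intro prime) auto
      also have "f X \<le> e X"
        using reduction_eq_below[OF red sub _ that(1)] \<open>2 \<le> e ?A\<close> le by linarith
      finally show ?thesis .
    qed
    have "card ?A \<le> card P + card Q + card R"
      unfolding U[symmetric] by (meson add_le_mono1 card_Un_le le_trans)
    then have "2 \<le> card P \<or> 2 \<le> card Q \<or> 2 \<le> card R" using card by linarith
    then show "2 \<le> e P \<or> 2 \<le> e Q \<or> 2 \<le> e R" using big U by blast
  qed
  ultimately show ?thesis using reduction_pairD(1,2)[OF pair] by blast
qed

text \<open>
  The pair inequality for X and Y shows that they share at most one element; for X and the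
  complement of Y it shows that one of the two differences has at most one element.
\<close>

lemma obstructing_parts_meet:
  assumes pair: "reduction_pair V f v g h" and A: "v \<in> A" "A \<subseteq> V"
    and prime: "\<And>X. X \<subseteq> A \<Longrightarrow> 2 \<le> card X \<Longrightarrow> 2 \<le> f X"
    and X: "X \<subseteq> A - {v}" "g X \<le> 1" "2 \<le> card X"
    and Y: "Y \<subseteq> A - {v}" "h Y \<le> 1" "2 \<le> card Y"
  shows "card (X \<inter> Y) = 1" and "card X = 2 \<or> card Y = 2"
proof -
  interpret h: connectivity "V - {v}" h using reductionD(1)[OF reduction_pairD(2)[OF pair]] .
  have finA: "finite A" using A finite_ground finite_subset by blast
  have fin: "finite X" "finite Y" using X Y finA by (meson finite_Diff finite_subset)+
  have sub: "X \<subseteq> V - {v}" "Y \<subseteq> V - {v}" "V - {v} - Y \<subseteq> V - {v}" using A X Y by auto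
  have "card X \<le> card (insert v (X \<union> Y))" using fin by (intro card_mono) auto
  then have "2 \<le> f (insert v (X \<union> Y))" using X Y A by (intro prime) auto
  then have "f (X \<inter> Y) \<le> 1" using reduction_pairD(3)[OF pair sub(1,2)] X(2) Y(2) by linarith
  then have "card (X \<inter> Y) \<le> 1" using prime[of "X \<inter> Y"] X by force
  moreover have "card (X - Y) \<le> 1 \<or> card (Y - X) \<le> 1"
  proof (rule ccontr)
    assume *: "\<not> ?thesis"
    have "f (X \<inter> (V - {v} - Y)) + f (V - {v} - X - (V - {v} - Y)) \<le> g X + h (V - {v} - Y) + 1"
      using A by (intro reduction_pair_crossing[OF pair] sub) auto
    moreover have "X \<inter> (V - {v} - Y) = X - Y" "V - {v} - X - (V - {v} - Y) = Y - X"
      using sub by auto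
    moreover have "h (V - {v} - Y) = h Y" using h.symmetric[OF sub(2)] .
    moreover have "2 \<le> f (X - Y)" "2 \<le> f (Y - X)"
      using * X Y by (intro prime; force)+
    ultimately show False using X(2) Y(2) by simp
  qed
  moreover have "card X = card (X \<inter> Y) + card (X - Y)" "card Y = card (X \<inter> Y) + card (Y - X)"
    using fin by (metis Int_commute card_Int_Diff card.infinite)+
  ultimately show "card (X \<inter> Y) = 1" "card X = 2 \<or> card Y = 2" using X Y by linarith+
qed

text \<open>
  X is a part of width at most 1 for the first reduction, and the sets Yi form a bad partition for
  the second. With v added they have width at most 2, and so has the union of \<open>insert v X\<close> with any
  Yi of two elements, since the two sets share v and a further element and hence intersect in a set
  of width at least 2. Each such union adds one element only. Counting shows that the sequence of
  unions grows from below \<open>A - {v}\<close> to all but at most one of its elements, so it contains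
  \<open>A - {v}\<close> without exactly one element u, contrary to the assumption that \<open>A - {u}\<close> has width
  more than 2.
\<close>

lemma no_double_obstruction:
  assumes pair: "reduction_pair V f v g h" and A: "v \<in> A" "A \<subseteq> V" "5 \<le> card A"
    and prime: "\<And>X. X \<subseteq> A \<Longrightarrow> 2 \<le> card X \<Longrightarrow> 2 \<le> f X"
    and lossy: "\<And>u. u \<in> A \<Longrightarrow> 2 < f (A - {u})"
    and X: "X \<subseteq> A - {v}" "g X \<le> 1" "2 \<le> card X"
    and Y: "Y1 \<union> Y2 \<union> Y3 = A - {v}" "Y1 \<inter> Y2 = {}" "Y1 \<inter> Y3 = {}" "Y2 \<inter> Y3 = {}"
      "h Y1 \<le> 1" "h Y2 \<le> 1" "h Y3 \<le> 1"
    and cY: "card Y1 \<le> 2" "card Y2 \<le> 2" "card Y3 \<le> 2"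
  shows False
proof -
  have finA: "finite A" using A finite_ground finite_subset by blast
  have finY: "finite Y1" "finite Y2" "finite Y3" using Y(1) finA by (metis finite_Diff finite_Un)+
  have cA: "card (A - {v}) = card Y1 + card Y2 + card Y3"
  proof -
    have "(Y1 \<union> Y2) \<inter> Y3 = {}" using Y by auto
    then show ?thesis unfolding Y(1)[symmetric] using finY Y(2) by (simp add: card_Un_disjoint)
  qed
  have cA4: "4 \<le> card (A - {v})" using A finA by simp
  define add where "add Y Z = (if card Y = 2 then Z \<union> Y else Z)" for Y Z :: "'a set"
  define ok where "ok Z \<longleftrightarrow> X \<subseteq> Z \<and> Z \<subseteq> A - {v} \<and> f (insert v Z) \<le> 2" for Z
  have insert_le: "f (insert v S) \<le> 2" if "S \<subseteq> A - {v}" "e S \<le> 1" "2 \<le> card S"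
    "reduction_pair V f v e e'" for S e e'
  proof -
    interpret e': connectivity "V - {v}" e' using reductionD(1)[OF reduction_pairD(2)[OF that(4)]] .
    have "f (S \<inter> {}) + f (insert v (S \<union> {})) \<le> e S + e' {} + 1"
      using that(1) A by (intro reduction_pairD(3)[OF that(4)]) auto
    then show ?thesis using that(2) e'.empty empty by simp
  qed
  have meet: "card (X \<inter> Yi) = 1"
    if "Yi \<in> {Y1, Y2, Y3}" "card Yi = 2" for Yi
    using obstructing_parts_meet(1)[OF pair A(1,2) prime X, of Yi] that Y by auto
  have add_ok: "ok (add Yi Z)" "card (add Yi Z) \<le> card Z + 1"
    if Z: "ok Z" and Yi: "Yi \<in> {Y1, Y2, Y3}" for Yi Z
  proof -
    have sub: "Yi \<subseteq> A - {v}" "Z \<subseteq> A - {v}" using Yi Y(1) Z by (auto simp: ok_def)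
    have fin: "finite Yi" "finite Z" using sub finA by (meson finite_Diff finite_subset)+
    have "ok (Z \<union> Yi) \<and> card (Z \<union> Yi) \<le> card Z + 1" if c: "card Yi = 2"
    proof -
      have "card (X \<inter> Yi) \<le> card (Z \<inter> Yi)" using Z fin by (intro card_mono) (auto simp: ok_def)
      then have one: "1 \<le> card (Z \<inter> Yi)" using meet[OF Yi c] by simp
      have "v \<notin> Z \<inter> Yi" using sub by auto
      then have "card (insert v (Z \<inter> Yi)) = Suc (card (Z \<inter> Yi))" using fin by simp
      then have "2 \<le> f (insert v (Z \<inter> Yi))" using one sub A by (intro prime) auto
      moreover have "f (insert v Z \<union> insert v Yi) + f (insert v Z \<inter> insert v Yi)
          \<le> f (insert v Z) + f (insert v Yi)"
        using sub A by (intro submodular) auto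
      moreover have "insert v Z \<inter> insert v Yi = insert v (Z \<inter> Yi)"
        "insert v Z \<union> insert v Yi = insert v (Z \<union> Yi)" by auto
      moreover have "h Yi \<le> 1" using Yi Y by auto
      then have "f (insert v Yi) \<le> 2"
        using insert_le[OF sub(1) _ _ reduction_pair_commute[OF pair]] c by simp
      moreover have "f (insert v Z) \<le> 2" using Z by (simp add: ok_def)
      ultimately have "f (insert v (Z \<union> Yi)) \<le> 2" by simp
      moreover have "card (Z \<union> Yi) + card (Z \<inter> Yi) = card Z + card Yi"
        using card_Un_Int[of Z Yi] fin by simp
      ultimately show ?thesis using Z sub one c by (auto simp: ok_def)
    qed
    then show "ok (add Yi Z)" "card (add Yi Z) \<le> card Z + 1" using Z by (auto simp: add_def)
  qed
  (* Such a Z would miss exactly one element u of A - {v}, and A - {u} would have width at most 2. *)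
  have not_pred: "card Z \<noteq> card (A - {v}) - 1" if "ok Z" for Z
  proof
    assume *: "card Z = card (A - {v}) - 1"
    have Z: "Z \<subseteq> A - {v}" "f (insert v Z) \<le> 2" using that by (auto simp: ok_def)
    have "card (A - {v} - Z) = card (A - {v}) - card Z"
      using Z finA by (meson card_Diff_subset finite_Diff finite_subset)
    then have "card (A - {v} - Z) = 1" using * cA4 by simp
    then obtain u where u: "A - {v} - Z = {u}" by (auto simp: card_1_singleton_iff)
    then have "insert v Z = A - {u}" using Z A by auto
    moreover have "u \<in> A" using u by auto
    ultimately show False using lossy Z(2) by fastforce
  qed
  have step: "card (add Yi Z) < card (A - {v}) - 1"
    if "ok Z" "card Z < card (A - {v}) - 1" "Yi \<in> {Y1, Y2, Y3}" for Yi Z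
    using add_ok[OF that(1,3)] not_pred[of "add Yi Z"] that(2) by linarith
  have okX: "ok X" using X insert_le[OF _ _ _ pair] by (auto simp: ok_def)
  have "X \<noteq> A - {v}"
  proof
    assume XA: "X = A - {v}"
    have "card Y1 = 2 \<or> card Y2 = 2 \<or> card Y3 = 2" using cA cA4 cY by linarith
    then obtain Yi where Yi: "Yi \<in> {Y1, Y2, Y3}" "card Yi = 2" by auto
    then have "X \<inter> Yi = Yi" using XA Y(1) by auto
    then show False using meet[OF Yi] Yi(2) by simp
  qed
  then have "card X < card (A - {v})" using X finA by (intro psubset_card_mono) auto
  then have X0: "card X < card (A - {v}) - 1" using not_pred[OF okX] by linarith
  define Z where "Z = add Y3 (add Y2 (add Y1 X))"
  have "ok (add Y1 X)" "card (add Y1 X) < card (A - {v}) - 1"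
    using add_ok(1)[OF okX] step[OF okX X0] by auto
  then have "ok (add Y2 (add Y1 X))" "card (add Y2 (add Y1 X)) < card (A - {v}) - 1"
    using add_ok(1) step by auto
  then have Z: "ok Z" "card Z < card (A - {v}) - 1"
    using add_ok(1) step unfolding Z_def by auto
  have sub: "X \<subseteq> Z" "card Yi = 2 \<Longrightarrow> Yi \<in> {Y1, Y2, Y3} \<Longrightarrow> Yi \<subseteq> Z" for Yi
    by (auto simp: Z_def add_def)
  let ?W = "A - {v} - Z"
  have finZ: "finite Z" using Z(1) finA by (auto simp: ok_def intro: finite_subset)
  have "card ?W = card (A - {v}) - card Z"
    using Z(1) finZ by (intro card_Diff_subset) (auto simp: ok_def)
  then have W2: "2 \<le> card ?W" using Z(2) by linarith
  have "?W = (Y1 - Z) \<union> (Y2 - Z) \<union> (Y3 - Z)" using Y(1) by auto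
  then have cW: "card ?W \<le> card (Y1 - Z) + card (Y2 - Z) + card (Y3 - Z)"
    using card_Un_le[of "(Y1 - Z) \<union> (Y2 - Z)" "Y3 - Z"] card_Un_le[of "Y1 - Z" "Y2 - Z"] by simp
  (* The coefficients are chosen such that the sum over the three Yi contradicts the lower bounds
     4, 2 and 2 for the sizes of A - {v}, ?W and X. *)
  have weight: "card Yi + 2 * card (Yi - Z) + card (X \<inter> Yi) \<le> 3"
    if "Yi \<in> {Y1, Y2, Y3}" for Yi
  proof (cases "card Yi = 2")
    case True
    then have "Yi - Z = {}" using sub(2)[OF _ that] by auto
    then show ?thesis using True meet[OF that True] by (simp only: card.empty)
  next
    case False
    have fin: "finite Yi" and c: "card Yi \<le> 1" using that finY cY False by auto
    have "card (Yi - Z) + card (X \<inter> Yi) = card ((Yi - Z) \<union> (X \<inter> Yi))"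
      using fin sub(1) by (intro card_Un_disjoint[symmetric]) auto
    also have "\<dots> \<le> card Yi" using fin by (intro card_mono) auto
    finally show ?thesis using c by linarith
  qed
  have "card X = card (X \<inter> Y1) + card (X \<inter> Y2) + card (X \<inter> Y3)"
  proof -
    have "X = (X \<inter> Y1) \<union> (X \<inter> Y2) \<union> (X \<inter> Y3)" using X(1) Y(1) by auto
    moreover have "((X \<inter> Y1) \<union> (X \<inter> Y2)) \<inter> (X \<inter> Y3) = {}" "(X \<inter> Y1) \<inter> (X \<inter> Y2) = {}"
      using Y by auto
    ultimately show ?thesis using finY by (metis card_Un_disjoint finite_Int finite_UnI)
  qed
  moreover have "card Y1 + 2 * card (Y1 - Z) + card (X \<inter> Y1) \<le> 3"
    "card Y2 + 2 * card (Y2 - Z) + card (X \<inter> Y2) \<le> 3"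
    "card Y3 + 2 * card (Y3 - Z) + card (X \<inter> Y3) \<le> 3"
    by (rule weight; simp)+
  ultimately show False
    using W2 cA cA4 cW X(3) by linarith
qed

lemma titanic_of_rank_two_cut:
  assumes pair: "\<And>v. v \<in> A \<Longrightarrow> reduction_pair V f v (g v) (h v)"
    and A: "A \<subseteq> V" "f A = 2" "5 \<le> card A"
    and prime: "\<And>X. X \<subseteq> A \<Longrightarrow> 2 \<le> card X \<Longrightarrow> 2 \<le> f X"
  shows "\<exists>v\<in>A. titanic (g v) 2 (A - {v}) \<or> titanic (h v) 2 (A - {v})"
proof (cases "\<exists>u\<in>A. f (A - {u}) \<le> 2")
  case True
  then show ?thesis using titanic_of_lossless_deletion[OF pair] A prime by blast
next
  case False
  then have lossy: "\<And>u. u \<in> A \<Longrightarrow> 2 < f (A - {u})" by force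
  obtain v where v: "v \<in> A" using A(3) by fastforce
  have finA: "finite A" using A finite_ground finite_subset by blast
  have "titanic (g v) 2 (A - {v}) \<or> titanic (h v) 2 (A - {v})"
  proof (rule ccontr)
    assume "\<not> ?thesis"
    then obtain X1 X2 X3 Y1 Y2 Y3 where
      X: "X1 \<union> X2 \<union> X3 = A - {v}" "X1 \<inter> X2 = {}" "X1 \<inter> X3 = {}" "X2 \<inter> X3 = {}"
        "g v X1 \<le> 1" "g v X2 \<le> 1" "g v X3 \<le> 1" and
      Y: "Y1 \<union> Y2 \<union> Y3 = A - {v}" "Y1 \<inter> Y2 = {}" "Y1 \<inter> Y3 = {}" "Y2 \<inter> Y3 = {}"
        "h v Y1 \<le> 1" "h v Y2 \<le> 1" "h v Y3 \<le> 1"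
      unfolding titanic_def by (metis One_nat_def Suc_1 not_less_eq_eq)
    have large: "\<exists>S\<in>{S1, S2, S3}. 2 \<le> card S" if "S1 \<union> S2 \<union> S3 = A - {v}" for S1 S2 S3 :: "'a set"
    proof -
      have "card (A - {v}) \<le> card S1 + card S2 + card S3"
        unfolding that[symmetric] by (meson add_le_mono1 card_Un_le le_trans)
      then have "2 \<le> card S1 \<or> 2 \<le> card S2 \<or> 2 \<le> card S3" using A(3) finA v by auto
      then show ?thesis by auto
    qed
    have parts: "S \<in> {X1, X2, X3} \<Longrightarrow> S \<subseteq> A - {v} \<and> g v S \<le> 1"
      "S \<in> {Y1, Y2, Y3} \<Longrightarrow> S \<subseteq> A - {v} \<and> h v S \<le> 1" for S
      using X Y by auto
    have two: "card S = 2 \<or> card T = 2"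
      if "S \<in> {X1, X2, X3}" "T \<in> {Y1, Y2, Y3}" "2 \<le> card S" "2 \<le> card T" for S T
      using obstructing_parts_meet(2)[OF pair[OF v] v A(1) prime, of S T] that(3,4) parts(1)[OF that(1)] parts(2)[OF that(2)]
      by blast
    show False
    proof (cases "\<forall>T\<in>{Y1, Y2, Y3}. card T \<le> 2")
      case True
      obtain S where S: "S \<in> {X1, X2, X3}" "2 \<le> card S" using large[OF X(1)] by blast
      have T: "card Y1 \<le> 2" "card Y2 \<le> 2" "card Y3 \<le> 2" using True by auto
      then show False
        using no_double_obstruction[OF pair[OF v] v A(1,3) prime lossy _ _ _ Y T, of S] parts(1)[OF S(1)] S(2) by blast
    next
      case False
      then obtain T where T: "T \<in> {Y1, Y2, Y3}" "2 < card T" by force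
      have "card S \<le> 2" if "S \<in> {X1, X2, X3}" for S
        using two[OF that T(1)] T(2) by (cases "2 \<le> card S") auto
      then have S: "card X1 \<le> 2" "card X2 \<le> 2" "card X3 \<le> 2" by auto
      have T2: "2 \<le> card T" using T(2) by simp
      then show False
        using no_double_obstruction[OF reduction_pair_commute[OF pair[OF v]] v A(1,3) prime lossy _ _ _ X S, of T]
          parts(2)[OF T(1)] T2 by blast
    qed
  qed
  then show ?thesis using v by blast
qed

end

section \<open>The size of a minimal obstruction\<close>

text \<open>
  An upper bound for the smaller side of a cut of width m in a minimal obstruction. The recursion
  would give 7 at 2; the smaller start value 4 is what \<open>titanic_of_rank_two_cut\<close> makes possible.
\<close>

fun cut_bound :: "nat \<Rightarrow> nat" where
  "cut_bound 0 = 0"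
| "cut_bound (Suc 0) = 1"
| "cut_bound (Suc (Suc 0)) = 4"
| "cut_bound (Suc (Suc (Suc n))) = 6 * cut_bound (Suc (Suc n)) + 1"

lemma cut_bound_numeral: "cut_bound 1 = 1" "cut_bound 2 = 4"
  by (simp_all add: numeral_2_eq_2)

lemma cut_bound_rec:
  assumes "m \<noteq> 0" "m \<noteq> 2"
  shows "cut_bound m = 6 * cut_bound (m - 1) + 1"
  using assms by (cases m rule: cut_bound.cases) auto

lemma mono_cut_bound: "mono cut_bound"
  unfolding mono_iff_le_Suc
proof
  fix n show "cut_bound n \<le> cut_bound (Suc n)" by (cases n rule: cut_bound.cases) auto
qed

lemma cut_bound_closed_form:
  assumes "2 \<le> k"
  shows "real (6 * cut_bound k + 1) = ((7 / 12) * 6 ^ (k + 1) - 1) / 5"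
  using assms
proof (induction k rule: nat_induct_at_least)
  case base
  then show ?case by (simp add: cut_bound_numeral)
next
  case (Suc k)
  then have "cut_bound (Suc k) = 6 * cut_bound k + 1" using cut_bound_rec[of "Suc k"] by simp
  then show ?case using Suc.IH by (simp add: field_simps)
qed

text \<open>
  All that is used about a graph that is minimal of rank-width larger than k.
\<close>

locale minimal_obstruction = connectivity +
  fixes k :: nat and g h :: "'a \<Rightarrow> 'a set \<Rightarrow> nat"
  assumes k: "2 \<le> k"
    and pair: "v \<in> V \<Longrightarrow> reduction_pair V f v (g v) (h v)"
    and branched_reduct: "v \<in> V \<Longrightarrow> V - {v} \<noteq> {} \<Longrightarrow>
      branched (g v) k (V - {v}) \<and> branched (h v) k (V - {v})"
    and not_branched: "\<not> branched f k V"
begin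

text \<open>
  The three cases provide a titanic set. For m = 0 every set is titanic, for m = 2 the refined
  argument for cuts of width two applies, and otherwise the doubled bounds of one reduction do.
\<close>

lemma branched_large_side:
  assumes small: "small_cuts V f m cut_bound" and m: "m \<le> k"
    and A: "A \<subseteq> V" "f A = m" "cut_bound m < card A" "cut_bound m < card (V - A)"
  shows "branched f k (V - A)"
proof -
  have "\<exists>v\<in>A. titanic (g v) m (A - {v}) \<or> titanic (h v) m (A - {v})"
  proof -
    obtain v where v: "v \<in> A" using A(3) by fastforce
    have finA: "finite A" using A finite_ground finite_subset by blast
    consider "m = 0" | "m = 2" | "m \<noteq> 0" "m \<noteq> 2" by blast
    then show ?thesis
    proof cases
      case 1
      then show ?thesis using v by (auto simp: titanic_def)
    next
      case 2
      have prime: "2 \<le> f X" if X: "X \<subseteq> A" "2 \<le> card X" for X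
      proof (rule ccontr)
        assume "\<not> 2 \<le> f X"
        then have "f X < m" "f X \<le> 1" using 2 by auto
        then have "card X \<le> cut_bound (f X) \<or> card (V - X) \<le> cut_bound (f X)"
          using small X A unfolding small_cuts_def by blast
        moreover have "cut_bound (f X) \<le> 1"
          using monoD[OF mono_cut_bound \<open>f X \<le> 1\<close>] by (simp add: cut_bound_numeral)
        moreover have "card (V - A) \<le> card (V - X)"
          using X finite_ground by (intro card_mono) auto
        ultimately show False using A(4) X(2) 2 by (simp add: cut_bound_numeral)
      qed
      have five: "5 \<le> card A" using A(3) 2 by (simp add: cut_bound_numeral)
      have fA: "f A = 2" using A(2) 2 by simp
      have pairA: "reduction_pair V f v (g v) (h v)" if "v \<in> A" for v
        using pair that A(1) by blast
      show ?thesis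
        unfolding 2 using pairA A(1) fA five prime by (rule titanic_of_rank_two_cut)
    next
      case 3
      have vV: "v \<in> V" using v A by auto
      (* One of three parts of A - {v} has more than twice cut_bound (m - 1) elements. *)
      have rec: "cut_bound m = 6 * cut_bound (m - 1) + 1" using cut_bound_rec 3 by simp
      then have big: "6 * cut_bound (m - 1) + 1 < card A" "2 * cut_bound (m - 1) < card (V - A)"
        using A(3,4) by linarith+
      note red = reduction_pairD(1,2)[OF pair[OF vV]]
      have "small_cuts (V - {v}) (g v) m (\<lambda>i. 2 * cut_bound i) \<or>
          small_cuts (V - {v}) (h v) m (\<lambda>i. 2 * cut_bound i)"
        using reduction_small_cuts[OF pair[OF vV] vV small mono_cut_bound] .
      then show ?thesis
        using titanic_of_small_cuts[OF red(1) _ mono_cut_bound v A(1) big]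
          titanic_of_small_cuts[OF red(2) _ mono_cut_bound v A(1) big] v by blast
    qed
  qed
  then obtain v where v: "v \<in> A" "titanic (g v) m (A - {v}) \<or> titanic (h v) m (A - {v})" by blast
  have vV: "v \<in> V" using v A by auto
  have "V - A \<noteq> {}" using A(4) by (metis card.empty not_less_zero)
  then have ne: "A \<noteq> V" "V - {v} \<noteq> {}" using v by auto
  have le: "f A \<le> k" using A(2) m by simp
  have tit: "titanic (g v) (f A) (A - {v}) \<or> titanic (h v) (f A) (A - {v})" using v(2) A(2) by simp
  note red = reduction_pairD(1,2)[OF pair[OF vV]]
  show ?thesis
    using tit branched_reduct[OF vV ne(2)]
      branched_complement_of_reduction[OF red(1) _ v(1) A(1) ne(1) le]
      branched_complement_of_reduction[OF red(2) _ v(1) A(1) ne(1) le] by blast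
qed

lemma small_cuts_cut_bound:
  assumes "m \<le> Suc k"
  shows "small_cuts V f m cut_bound"
  using assms
proof (induction m)
  case 0
  then show ?case by (simp add: small_cuts_def)
next
  case (Suc m)
  then have small: "small_cuts V f m cut_bound" and m: "m \<le> k" by auto
  show ?case unfolding small_cuts_def
  proof (intro allI impI)
    fix X assume X: "X \<subseteq> V" "f X < Suc m"
    show "card X \<le> cut_bound (f X) \<or> card (V - X) \<le> cut_bound (f X)"
    proof (cases "f X = m")
      case False
      then show ?thesis using small X unfolding small_cuts_def by auto
    next
      case True
      show ?thesis
      proof (rule ccontr)
        assume "\<not> ?thesis"
        then have big: "cut_bound m < card X" "cut_bound m < card (V - X)" using True by auto
        have comp: "V - (V - X) = X" using X by auto
        have "branched f k (V - X)"
          using branched_large_side[OF small m X(1) True big] .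
        moreover have "branched f k (V - (V - X))"
          using X big comp True symmetric by (intro branched_large_side[OF small m]) auto
        moreover have "(V - X) \<union> (V - (V - X)) = V" "(V - X) \<inter> (V - (V - X)) = {}" by auto
        ultimately have "branched f k V"
          using branched.join[of f k "V - X" "V - (V - X)"] ground by simp
        then show False using not_branched by simp
      qed
    qed
  qed
qed

theorem card_ground_le: "card V \<le> 6 * cut_bound k + 1"
proof (rule ccontr)
  assume large: "\<not> ?thesis"
  then obtain v where v: "v \<in> V" by fastforce
  have card: "3 * (2 * cut_bound k) < card (V - {v})" using large v finite_ground by simp
  have pos: "0 < 2 * cut_bound k"
    using monoD[OF mono_cut_bound k] by (simp add: cut_bound_numeral)
  have False if red: "reduction V f v e" and br: "branched e k (V - {v})"
    and small: "small_cuts (V - {v}) e (Suc k) (\<lambda>i. 2 * cut_bound i)" for e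
  proof -
    interpret e: connectivity "V - {v}" e using reductionD(1)[OF red] .
    obtain S where S: "S \<subseteq> V - {v}" "e S \<le> k" "2 * cut_bound k < card S"
      "2 * cut_bound k < card (V - {v} - S)"
      using e.branched_balanced_cut[OF br card pos] .
    have "cut_bound (e S) \<le> cut_bound k" using mono_cut_bound S(2) by (rule monoD)
    moreover have "card S \<le> 2 * cut_bound (e S) \<or> card (V - {v} - S) \<le> 2 * cut_bound (e S)"
      using small S(1,2) unfolding small_cuts_def by auto
    ultimately show False using S(3,4) by linarith
  qed
  moreover have "V - {v} \<noteq> {}" using card by fastforce
  ultimately show False
    using reduction_small_cuts[OF pair[OF v] v small_cuts_cut_bound[OF order_refl] mono_cut_bound]
      reduction_pairD(1,2)[OF pair[OF v]] branched_reduct[OF v] by blast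
qed

end

section \<open>Rank over GF(2)\<close>

text \<open>
  Rewriting arithmetic on \<^typ>\<open>bit\<close> to bitwise operations would hide the ring structure of GF(2).
\<close>
declare add_bit_eq_xor [simp del] mult_bit_eq_and [simp del] minus_bit_def [simp del]

lemma bit_add_eq_0_iff: "a + b = 0 \<longleftrightarrow> b = a" for a b :: bit
  by (cases a; cases b) auto

lemma sum_fun_apply: "(\<Sum>i\<in>I. f i) x = (\<Sum>i\<in>I. f i x)"
  by (induction I rule: infinite_finite_induct) auto

text \<open>
  The homomorphism theorem for finite groups as a counting statement. Over GF(2) a subspace of
  dimension d has 2^d elements, so this serves as the dimension formula.
\<close>

lemma card_kernel_image:
  fixes h :: "'b::ab_group_add \<Rightarrow> 'c::ab_group_add"
  assumes fin: "finite A" and diff: "\<And>a b. a \<in> A \<Longrightarrow> b \<in> A \<Longrightarrow> a - b \<in> A"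
    and add: "\<And>a b. a \<in> A \<Longrightarrow> b \<in> A \<Longrightarrow> a + b \<in> A \<and> h (a + b) = h a + h b"
  shows "card A = card {a \<in> A. h a = 0} * card (h ` A)"
proof -
  have fiber: "card {a \<in> A. h a = y} = card {a \<in> A. h a = 0}" if y: "y \<in> h ` A" for y
  proof -
    obtain a0 where a0: "a0 \<in> A" "y = h a0" using y by blast
    have hdiff: "h (a - a0) = h a - h a0" if "a \<in> A" for a
      using add[of "a - a0" a0] diff[of a a0] that a0 by (simp add: algebra_simps)
    have "bij_betw (\<lambda>a. a - a0) {a \<in> A. h a = y} {a \<in> A. h a = 0}"
      by (rule bij_betw_byWitness[where f' = "\<lambda>a. a + a0"])
        (use a0 add diff hdiff in auto)
    then show ?thesis by (rule bij_betw_same_card)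
  qed
  have "A = (\<Union>y\<in>h ` A. {a \<in> A. h a = y})" by auto
  then have "card A = card (\<Union>y\<in>h ` A. {a \<in> A. h a = y})" by simp
  also have "\<dots> = (\<Sum>y\<in>h ` A. card {a \<in> A. h a = y})"
    using fin by (intro card_UN_disjoint) auto
  also have "\<dots> = card {a \<in> A. h a = 0} * card (h ` A)"
    using fiber by simp
  finally show ?thesis .
qed

lemma card_span_independent:
  assumes "finite B" "gf2.independent B"
  shows "card (gf2.span B) = 2 ^ card B \<and> finite (gf2.span B)"
  using assms
proof (induction B rule: finite_induct)
  case empty
  then show ?case by simp
next
  case (insert b B)
  have ind: "gf2.independent B" "b \<notin> gf2.span B"
    using insert.prems insert.hyps gf2.independent_insert[of b B] by auto
  have "gf2.span (insert b B) = gf2.span B \<union> (\<lambda>x. x + b) ` gf2.span B"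
  proof (intro equalityI subsetI)
    fix x assume "x \<in> gf2.span (insert b B)"
    then obtain k where k: "x - (\<lambda>y. k * b y) \<in> gf2.span B" by (auto simp: gf2.span_insert)
    have "k = 0 \<or> k = 1" by (cases k) auto
    then show "x \<in> gf2.span B \<union> (\<lambda>x. x + b) ` gf2.span B"
    proof
      assume "k = 0"
      then have "x - (\<lambda>y. k * b y) = x" by (auto simp: fun_eq_iff)
      then show ?thesis using k by (metis UnI1)
    next
      assume "k = 1"
      then have "x = (x - (\<lambda>y. k * b y)) + b" by (auto simp: fun_eq_iff)
      then show ?thesis using k by blast
    qed
  next
    fix x assume "x \<in> gf2.span B \<union> (\<lambda>x. x + b) ` gf2.span B"
    then show "x \<in> gf2.span (insert b B)"
      using gf2.span_mono[of B "insert b B"] gf2.span_base[of b "insert b B"]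
      by (auto intro: gf2.span_add)
  qed
  moreover have "gf2.span B \<inter> (\<lambda>x. x + b) ` gf2.span B = {}"
  proof (rule ccontr)
    assume "\<not> ?thesis"
    then obtain x where "x \<in> gf2.span B" "x + b \<in> gf2.span B" by auto
    then have "x + b - x \<in> gf2.span B" by (rule gf2.span_diff[rotated])
    then show False using ind by simp
  qed
  moreover have "card ((\<lambda>x. x + b) ` gf2.span B) = card (gf2.span B)"
    by (intro card_image) (auto simp: inj_on_def)
  ultimately show ?case
    using insert.IH[OF ind(1)] insert.hyps by (simp add: card_Un_disjoint)
qed

lemma card_span:
  assumes "finite S"
  shows "card (gf2.span S) = 2 ^ gf2.dim S"
proof -
  obtain B where B: "B \<subseteq> S" "gf2.independent B" "S \<subseteq> gf2.span B" "card B = gf2.dim S"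
    using gf2.basis_exists[of S] by blast
  have "gf2.span B = gf2.span S"
    using B gf2.span_mono[of B S] gf2.span_minimal[OF B(3) gf2.subspace_span] by blast
  then show ?thesis using card_span_independent[of B] B assms finite_subset by metis
qed

text \<open>
  Rows are extended by 0 outside Y, in agreement with \<^const>\<open>cut_row\<close>.
\<close>

definition row_on :: "('a \<Rightarrow> 'b \<Rightarrow> bit) \<Rightarrow> 'b set \<Rightarrow> 'a \<Rightarrow> 'b \<Rightarrow> bit" where
  "row_on M Y x = (\<lambda>y. if y \<in> Y then M x y else 0)"

definition rank_on :: "('a \<Rightarrow> 'b \<Rightarrow> bit) \<Rightarrow> 'a set \<Rightarrow> 'b set \<Rightarrow> nat" where
  "rank_on M X Y = gf2.dim (row_on M Y ` X)"

definition supported :: "'a set \<Rightarrow> ('a \<Rightarrow> bit) set" where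
  "supported X = {c. \<forall>x. x \<notin> X \<longrightarrow> c x = 0}"

text \<open>
  The linear dependencies among the rows in X, restricted to the columns in Y. Unlike ranks, these
  spaces behave well under union and intersection of the index sets.
\<close>

definition left_kernel :: "('a \<Rightarrow> 'b \<Rightarrow> bit) \<Rightarrow> 'a set \<Rightarrow> 'b set \<Rightarrow> ('a \<Rightarrow> bit) set" where
  "left_kernel M X Y = {c \<in> supported X. \<forall>y\<in>Y. (\<Sum>x\<in>X. c x * M x y) = 0}"

lemma card_supported:
  assumes "finite X"
  shows "card (supported X) = 2 ^ card X" "finite (supported X)"
proof -
  have "bij_betw (\<lambda>c. {x. c x = 1}) (supported X) (Pow X)"
    by (rule bij_betw_byWitness[where f' = "\<lambda>S x. if x \<in> S then 1 else 0"])
      (auto simp: supported_def fun_eq_iff)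
  then show "card (supported X) = 2 ^ card X" "finite (supported X)"
    using assms bij_betw_same_card bij_betw_finite by (metis card_Pow, metis finite_Pow_iff)
qed

lemma rank_nullity:
  assumes "finite X"
  shows "card (left_kernel M X Y) * 2 ^ rank_on M X Y = 2 ^ card X"
proof -
  define h where "h c = (\<Sum>x\<in>X. (\<lambda>y. c x * row_on M Y x y))" for c :: "'a \<Rightarrow> bit"
  have h_apply: "h c y = (if y \<in> Y then \<Sum>x\<in>X. c x * M x y else 0)" for c y
    by (simp add: h_def row_on_def sum_fun_apply)
  have "h ` supported X = gf2.span (row_on M Y ` X)"
  proof
    show "h ` supported X \<subseteq> gf2.span (row_on M Y ` X)"
      unfolding h_def by (intro image_subsetI gf2.span_sum gf2.span_scale gf2.span_base) auto
    have sub: "gf2.subspace (h ` supported X)"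
    proof (rule gf2.subspaceI)
      show "0 \<in> h ` supported X"
        by (rule image_eqI[of _ _ 0]) (auto simp: fun_eq_iff h_apply supported_def)
    next
      fix a b assume "a \<in> h ` supported X" "b \<in> h ` supported X"
      then obtain c d where "a = h c" "b = h d" "c \<in> supported X" "d \<in> supported X" by blast
      then show "a + b \<in> h ` supported X"
        by (intro image_eqI[of _ _ "c + d"])
          (auto simp: fun_eq_iff h_apply supported_def distrib_right sum.distrib)
    next
      fix k a assume "a \<in> h ` supported X"
      then obtain c where "a = h c" "c \<in> supported X" by blast
      then show "(\<lambda>y. k * a y) \<in> h ` supported X"
        by (intro image_eqI[of _ _ "\<lambda>x. k * c x"])
          (auto simp: fun_eq_iff h_apply supported_def sum_distrib_left mult.assoc)
    qed
    have "row_on M Y x \<in> h ` supported X" if "x \<in> X" for x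
    proof (rule image_eqI)
      show "(\<lambda>z. if z = x then 1 else 0) \<in> supported X" using that by (auto simp: supported_def)
      show "row_on M Y x = h (\<lambda>z. if z = x then 1 else 0)"
        using that assms by (auto simp: fun_eq_iff h_apply row_on_def if_distrib[of "\<lambda>c. c * _"] cong: if_cong)
    qed
    then show "gf2.span (row_on M Y ` X) \<subseteq> h ` supported X"
      by (intro gf2.span_minimal sub) auto
  qed
  then have "card (h ` supported X) = 2 ^ rank_on M X Y"
    using assms by (simp add: card_span rank_on_def)
  moreover have "{c \<in> supported X. h c = 0} = left_kernel M X Y"
    by (auto simp: left_kernel_def fun_eq_iff h_apply split: if_splits)
  moreover have "card (supported X) = card {c \<in> supported X. h c = 0} * card (h ` supported X)"
  proof (rule card_kernel_image)
    fix a b assume ab: "a \<in> supported X" "b \<in> supported X"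
    then show "a - b \<in> supported X" by (auto simp: supported_def)
    show "a + b \<in> supported X \<and> h (a + b) = h a + h b"
      using ab by (auto simp: supported_def fun_eq_iff h_apply distrib_right sum.distrib)
  qed (use assms card_supported in auto)
  ultimately show ?thesis using card_supported assms by metis
qed

lemma sum_supported:
  assumes "finite X'" "c \<in> supported X" "X \<subseteq> X'"
  shows "(\<Sum>x\<in>X'. c x * m x) = (\<Sum>x\<in>X. c x * m x)"
  using assms by (intro sum.mono_neutral_right) (auto simp: supported_def)

text \<open>
  The left kernels N1 and N2 of the two matrices on the right satisfy that their intersection is
  the kernel of one matrix on the left and that their sum lies in the kernel of the other. So this
  is the dimension formula for N1 and N2, in the form |N1| |N2| = |N1 \<inter> N2| |N1 + N2|.
\<close>

theorem rank_on_submodular: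
  assumes fin: "finite X1" "finite X2"
  shows "rank_on M (X1 \<union> X2) (Y1 \<inter> Y2) + rank_on M (X1 \<inter> X2) (Y1 \<union> Y2)
    \<le> rank_on M X1 Y1 + rank_on M X2 Y2"
proof -
  let ?N1 = "left_kernel M X1 Y1" and ?N2 = "left_kernel M X2 Y2"
  let ?Nu = "left_kernel M (X1 \<union> X2) (Y1 \<inter> Y2)" and ?Ni = "left_kernel M (X1 \<inter> X2) (Y1 \<union> Y2)"
  let ?add = "\<lambda>(a, b). a + b :: 'a \<Rightarrow> bit"
  have finN: "finite (left_kernel M X Y)" if "finite X" for X Y
    using card_supported(2)[OF that] by (auto simp: left_kernel_def)
  have supp: "supported (X1 \<inter> X2) = supported X1 \<inter> supported X2"
    "supported X1 \<subseteq> supported (X1 \<union> X2)" "supported X2 \<subseteq> supported (X1 \<union> X2)"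
    by (auto simp: supported_def)
  have sums: "(\<Sum>x\<in>X1. c x * M x y) = (\<Sum>x\<in>X1 \<inter> X2. c x * M x y)"
    "(\<Sum>x\<in>X2. c x * M x y) = (\<Sum>x\<in>X1 \<inter> X2. c x * M x y)"
    if "c \<in> supported (X1 \<inter> X2)" for c y
    using that fin by (auto intro!: sum_supported)
  have inter: "?N1 \<inter> ?N2 = ?Ni"
    unfolding left_kernel_def using sums supp(1) by auto
  have kernel: "{p \<in> ?N1 \<times> ?N2. ?add p = 0} = (\<lambda>c. (c, c)) ` (?N1 \<inter> ?N2)"
  proof -
    have "a + b = 0 \<longleftrightarrow> b = a" for a b :: "'a \<Rightarrow> bit"
      by (auto simp: fun_eq_iff bit_add_eq_0_iff)
    then show ?thesis by auto
  qed
  have "?add ` (?N1 \<times> ?N2) \<subseteq> ?Nu"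
  proof clarify
    fix a b assume ab: "a \<in> ?N1" "b \<in> ?N2"
    then have s: "a \<in> supported X1" "b \<in> supported X2" by (auto simp: left_kernel_def)
    have "(\<Sum>x\<in>X1 \<union> X2. (a + b) x * M x y) = 0" if "y \<in> Y1 \<inter> Y2" for y
    proof -
      have "(\<Sum>x\<in>X1 \<union> X2. (a + b) x * M x y)
          = (\<Sum>x\<in>X1 \<union> X2. a x * M x y) + (\<Sum>x\<in>X1 \<union> X2. b x * M x y)"
        by (simp add: distrib_right sum.distrib)
      also have "(\<Sum>x\<in>X1 \<union> X2. a x * M x y) = (\<Sum>x\<in>X1. a x * M x y)"
        using fin s by (intro sum_supported) auto
      also have "(\<Sum>x\<in>X1 \<union> X2. b x * M x y) = (\<Sum>x\<in>X2. b x * M x y)"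
        using fin s by (intro sum_supported) auto
      finally show ?thesis using ab that by (simp add: left_kernel_def)
    qed
    moreover have "a + b \<in> supported (X1 \<union> X2)" using s by (auto simp: supported_def)
    ultimately show "a + b \<in> ?Nu" by (simp add: left_kernel_def)
  qed
  then have le: "card (?add ` (?N1 \<times> ?N2)) \<le> card ?Nu"
    using fin by (intro card_mono finN) auto
  have "card (?N1 \<times> ?N2) = card {p \<in> ?N1 \<times> ?N2. ?add p = 0} * card (?add ` (?N1 \<times> ?N2))"
  proof (rule card_kernel_image)
    show "finite (?N1 \<times> ?N2)" using fin finN by auto
  qed (auto simp: left_kernel_def supported_def distrib_right left_diff_distrib sum.distrib sum_subtractf)
  also have "card {p \<in> ?N1 \<times> ?N2. ?add p = 0} = card ?Ni"
    unfolding kernel inter by (rule card_image) (auto simp: inj_on_def)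
  finally have "card ?N1 * card ?N2 = card ?Ni * card (?add ` (?N1 \<times> ?N2))"
    by (simp only: card_cartesian_product)
  then have N: "card ?N1 * card ?N2 \<le> card ?Ni * card ?Nu"
    using mult_le_mono2[OF le] by metis
  note rn1 = rank_nullity[OF fin(1), of M Y1] and rn2 = rank_nullity[OF fin(2), of M Y2]
  have "card ?N1 \<noteq> 0" "card ?N2 \<noteq> 0" using rn1 rn2 by (metis mult_0 power_not_zero zero_neq_numeral)+
  then have pos: "0 < card ?N1 * card ?N2" by simp
  have finU: "finite (X1 \<union> X2)" "finite (X1 \<inter> X2)" using fin by auto
  note rnu = rank_nullity[OF finU(1), of M "Y1 \<inter> Y2"] and rni = rank_nullity[OF finU(2), of M "Y1 \<union> Y2"]
  let ?r = "rank_on M (X1 \<union> X2) (Y1 \<inter> Y2) + rank_on M (X1 \<inter> X2) (Y1 \<union> Y2)"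
  let ?s = "rank_on M X1 Y1 + rank_on M X2 Y2"
  have "card ?N1 * card ?N2 * 2 ^ ?s = (card ?N1 * 2 ^ rank_on M X1 Y1) * (card ?N2 * 2 ^ rank_on M X2 Y2)"
    by (simp only: power_add mult_ac)
  also have "\<dots> = 2 ^ (card X1 + card X2)" by (simp only: rn1 rn2 power_add)
  also have "card X1 + card X2 = card (X1 \<union> X2) + card (X1 \<inter> X2)"
    using fin by (rule card_Un_Int)
  also have "(2::nat) ^ \<dots> = (card ?Nu * 2 ^ rank_on M (X1 \<union> X2) (Y1 \<inter> Y2)) *
      (card ?Ni * 2 ^ rank_on M (X1 \<inter> X2) (Y1 \<union> Y2))"
    by (simp only: rnu rni power_add)
  also have "\<dots> = card ?Ni * card ?Nu * 2 ^ ?r" by (simp only: power_add mult_ac)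
  finally have "card ?N1 * card ?N2 * 2 ^ ?r \<le> card ?N1 * card ?N2 * 2 ^ ?s"
    using N by simp
  then have "(2::nat) ^ ?r \<le> 2 ^ ?s" using pos by simp
  then show ?thesis by simp
qed

text \<open>
  The rows are combinations of rank many basis rows; reading the coefficients column by column
  expresses every column as a combination of as many vectors.
\<close>

lemma rank_on_transpose_le:
  assumes "finite X"
  shows "rank_on (\<lambda>y x. M x y) Y X \<le> rank_on M X Y"
proof -
  obtain B where B: "B \<subseteq> row_on M Y ` X" "row_on M Y ` X \<subseteq> gf2.span B"
    "card B = rank_on M X Y"
    unfolding rank_on_def using gf2.basis_exists[of "row_on M Y ` X"] by metis
  have finB: "finite B" using B(1) assms by (meson finite_imageI finite_subset)
  have "\<exists>u. row_on M Y x = (\<Sum>b\<in>B. (\<lambda>y. u b * b y))" if "x \<in> X" for x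
    using B(2) that gf2.span_finite[OF finB] by auto
  then obtain u where u: "\<forall>x\<in>X. row_on M Y x = (\<Sum>b\<in>B. (\<lambda>y. u x b * b y))"
    using bchoice[of X "\<lambda>x u. row_on M Y x = (\<Sum>b\<in>B. (\<lambda>y. u b * b y))"] by blast
  define w where "w b = (\<lambda>x. if x \<in> X then u x b else 0)" for b
  have "row_on (\<lambda>y x. M x y) X y \<in> gf2.span (w ` B)" if "y \<in> Y" for y
  proof -
    have "row_on (\<lambda>y x. M x y) X y = (\<Sum>b\<in>B. (\<lambda>x. b y * w b x))"
    proof
      fix x
      show "row_on (\<lambda>y x. M x y) X y x = (\<Sum>b\<in>B. (\<lambda>x. b y * w b x)) x"
      proof (cases "x \<in> X")
        case True
        have "M x y = row_on M Y x y" using that by (simp add: row_on_def)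
        also have "\<dots> = (\<Sum>b\<in>B. u x b * b y)" using u True by (simp add: sum_fun_apply)
        finally show ?thesis using True by (simp add: row_on_def w_def sum_fun_apply mult.commute)
      next
        case False
        then show ?thesis by (simp add: row_on_def w_def sum_fun_apply)
      qed
    qed
    also have "\<dots> \<in> gf2.span (w ` B)"
      by (intro gf2.span_sum gf2.span_scale gf2.span_base) auto
    finally show ?thesis .
  qed
  then have "rank_on (\<lambda>y x. M x y) Y X \<le> card (w ` B)"
    unfolding rank_on_def using finB by (intro gf2.dim_le_card) auto
  also have "\<dots> \<le> card B" using finB by (rule card_image_le)
  finally show ?thesis using B(3) by simp
qed

lemma rank_on_transpose:
  assumes "finite X" "finite Y"
  shows "rank_on (\<lambda>y x. M x y) Y X = rank_on M X Y"
  using rank_on_transpose_le[OF assms(1), of M Y] rank_on_transpose_le[OF assms(2), of "\<lambda>y x. M x y" X]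
  by simp

lemma rank_on_cong:
  assumes "\<And>x y. x \<in> X \<Longrightarrow> y \<in> Y \<Longrightarrow> M x y = M' x y"
  shows "rank_on M X Y = rank_on M' X Y"
proof -
  have "row_on M Y ` X = row_on M' Y ` X"
    using assms by (intro image_cong) (auto simp: row_on_def)
  then show ?thesis by (simp add: rank_on_def)
qed

lemma rank_on_empty [simp]: "rank_on M {} Y = 0"
  using gf2.dim_le_card'[of "{}"] by (simp add: rank_on_def)

lemma rank_on_le_card: "finite X \<Longrightarrow> rank_on M X Y \<le> card X"
  unfolding rank_on_def using gf2.dim_le_card'[of "row_on M Y ` X"] card_image_le[of X "row_on M Y"]
  by simp

lemma rank_on_mono_columns:
  assumes "finite X" "Y \<subseteq> Y'"
  shows "rank_on M X Y \<le> rank_on M X Y'"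
  using rank_on_submodular[OF assms(1) finite.emptyI, of M Y' Y] assms(2) by (simp add: Int_absorb1)

lemma rank_on_insert_le:
  assumes "finite X"
  shows "rank_on M (insert v X) Y \<le> rank_on M X Y + 1"
  using rank_on_submodular[OF assms, of "{v}" M Y Y] rank_on_le_card[of "{v}" M Y] by simp

lemma rank_on_eq_of_card_left_kernel:
  assumes "finite X" "finite X'" "card X' = card X + 1"
    "card (left_kernel M X Y) = card (left_kernel M' X' Y')"
  shows "rank_on M' X' Y' = rank_on M X Y + 1"
proof -
  have a: "card (left_kernel M X Y) * 2 ^ rank_on M X Y = 2 ^ card X"
    "card (left_kernel M X Y) * 2 ^ rank_on M' X' Y' = 2 * 2 ^ card X"
    using rank_nullity[of X M Y] rank_nullity[of X' M' Y'] assms by simp_all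
  have "card (left_kernel M X Y) \<noteq> 0" using a(1) by (metis mult_zero_left power_not_zero zero_neq_numeral)
  moreover have "card (left_kernel M X Y) * 2 ^ rank_on M' X' Y' =
      card (left_kernel M X Y) * 2 ^ (rank_on M X Y + 1)"
    using a by simp
  ultimately have "(2::nat) ^ rank_on M' X' Y' = 2 ^ (rank_on M X Y + 1)" by simp
  then show ?thesis by (simp only: power_inject_exp)
qed

section \<open>Trees as connected relations in which every edge is a bridge\<close>

text \<open>
  The component of x after the edge between x and y has been cut.
\<close>

definition side :: "'t rel \<Rightarrow> 't \<Rightarrow> 't \<Rightarrow> 't set" where
  "side R x y = {z. (x, z) \<in> (R - {(x, y), (y, x)})\<^sup>*}"

text \<open>
  Trees as symmetric relations. That every edge is a bridge replaces the absence of cycles; it is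
  the form in which acyclicity is needed for the widths of edges, and it is easily preserved when
  two trees are joined.
\<close>

locale rel_tree =
  fixes V :: "'t set" and R :: "'t rel"
  assumes finite_nodes: "finite V" and nonempty: "V \<noteq> {}"
    and arcs_subset: "R \<subseteq> V \<times> V" and sym_arcs: "sym R" and irrefl_arcs: "irrefl R"
    and connected: "x \<in> V \<Longrightarrow> y \<in> V \<Longrightarrow> (x, y) \<in> R\<^sup>*"
    and bridge: "(x, y) \<in> R \<Longrightarrow> y \<notin> side R x y"

lemma side_base: "x \<in> side R x y"
  by (simp add: side_def)

lemma side_step:
  assumes "z \<in> side R x y" "(z, z') \<in> R" "(z, z') \<noteq> (x, y)" "(z, z') \<noteq> (y, x)"
  shows "z' \<in> side R x y"
  using assms unfolding side_def by (auto intro: rtrancl_into_rtrancl)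

lemma rtrancl_closed:
  assumes "(x, z) \<in> R\<^sup>*" "x \<in> U" "\<And>a b. a \<in> U \<Longrightarrow> (a, b) \<in> R \<Longrightarrow> b \<in> U"
  shows "z \<in> U"
  using assms(1,2,3) by (induction rule: rtrancl_induct) auto

lemma side_subset:
  assumes "x \<in> U"
    "\<And>a b. a \<in> U \<Longrightarrow> (a, b) \<in> R \<Longrightarrow> (a, b) \<noteq> (x, y) \<Longrightarrow> (a, b) \<noteq> (y, x) \<Longrightarrow> b \<in> U"
  shows "side R x y \<subseteq> U"
proof
  fix z assume "z \<in> side R x y"
  then have "(x, z) \<in> (R - {(x, y), (y, x)})\<^sup>*" by (simp add: side_def)
  then show "z \<in> U" by (rule rtrancl_closed) (use assms in auto)
qed

context rel_tree
begin

lemma arcD: "(x, y) \<in> R \<Longrightarrow> (y, x) \<in> R" "(x, y) \<in> R \<Longrightarrow> x \<in> V" "(x, y) \<in> R \<Longrightarrow> y \<in> V"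
  "(x, y) \<in> R \<Longrightarrow> x \<noteq> y"
  using sym_arcs arcs_subset irrefl_arcs by (auto dest: symD irreflD)

lemma side_in_nodes: "x \<in> V \<Longrightarrow> side R x y \<subseteq> V"
  by (rule side_subset) (auto dest: arcD)

lemma side_Un: "(x, y) \<in> R \<Longrightarrow> side R x y \<union> side R y x = V"
proof (intro equalityI)
  assume xy: "(x, y) \<in> R"
  show "side R x y \<union> side R y x \<subseteq> V" using xy side_in_nodes by (auto dest: arcD)
  show "V \<subseteq> side R x y \<union> side R y x"
  proof
    fix z assume "z \<in> V"
    then have "(x, z) \<in> R\<^sup>*" using connected xy by (auto dest: arcD)
    then show "z \<in> side R x y \<union> side R y x"
    proof (rule rtrancl_closed)
      fix a b assume ab: "a \<in> side R x y \<union> side R y x" "(a, b) \<in> R"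
      show "b \<in> side R x y \<union> side R y x"
      proof (cases "(a, b) = (x, y) \<or> (a, b) = (y, x)")
        case True
        then have "b = x \<or> b = y" by auto
        then show ?thesis using side_base by (metis UnI1 UnI2)
      next
        case False
        then show ?thesis using side_step[OF _ ab(2)] ab(1) by (metis UnE UnI1 UnI2)
      qed
    qed (simp add: side_base)
  qed
qed

lemma side_Int:
  assumes "(x, y) \<in> R"
  shows "side R x y \<inter> side R y x = {}"
proof (rule ccontr)
  assume "\<not> ?thesis"
  then obtain z where z: "z \<in> side R x y" "z \<in> side R y x" by auto
  let ?R = "R - {(x, y), (y, x)}"
  have "sym (?R\<^sup>*)" using sym_arcs by (intro sym_rtrancl) (auto simp: sym_def)
  moreover have "{(x, y), (y, x)} = {(y, x), (x, y)}" by auto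
  ultimately have "(x, z) \<in> ?R\<^sup>*" "(z, y) \<in> ?R\<^sup>*" using z by (auto simp: side_def dest: symD)
  then have "y \<in> side R x y" unfolding side_def by (auto intro: rtrancl_trans)
  then show False using bridge assms by blast
qed

lemma side_child_subset:
  assumes "(x, y) \<in> R" "(y, a) \<in> R" "a \<noteq> x"
  shows "side R a y \<subseteq> side R y x - {y}"
proof -
  have y: "y \<notin> side R a y" using bridge[OF arcD(1)[OF assms(2)]] .
  have "side R a y \<subseteq> side R a y \<inter> side R y x"
  proof (rule side_subset)
    show "a \<in> side R a y \<inter> side R y x"
      using side_step[OF side_base assms(2)] assms by (auto simp: side_base dest: arcD)
    fix z z' assume z: "z \<in> side R a y \<inter> side R y x" "(z, z') \<in> R" "(z, z') \<noteq> (a, y)" "(z, z') \<noteq> (y, a)"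
    then have z': "z' \<in> side R a y" using side_step[of z R a y z'] by simp
    have "z \<noteq> y" "z' \<noteq> y" using z z' y by auto
    then show "z' \<in> side R a y \<inter> side R y x" using z z' side_step[of z R y x z'] by auto
  qed
  then show ?thesis using y by auto
qed

text \<open>
  The recursive structure of a tree that is hung up at an edge.
\<close>

lemma side_eq_children:
  assumes "(x, y) \<in> R"
  shows "side R y x = insert y (\<Union>a\<in>R `` {y} - {x}. side R a y)"
proof
  show "insert y (\<Union>a\<in>R `` {y} - {x}. side R a y) \<subseteq> side R y x"
    using side_child_subset[OF assms] side_base[of y R x] by blast
  show "side R y x \<subseteq> insert y (\<Union>a\<in>R `` {y} - {x}. side R a y)"
  proof (rule side_subset)
    fix z z' assume z: "z \<in> insert y (\<Union>a\<in>R `` {y} - {x}. side R a y)" "(z, z') \<in> R"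
      "(z, z') \<noteq> (y, x)"
    show "z' \<in> insert y (\<Union>a\<in>R `` {y} - {x}. side R a y)"
    proof (cases "z = y")
      case True
      then have "z' \<in> R `` {y} - {x}" using z by auto
      then show ?thesis using side_base[of z' R y] by blast
    next
      case False
      then obtain a where a: "a \<in> R `` {y} - {x}" "z \<in> side R a y" using z by auto
      show ?thesis
      proof (cases "z' = y")
        case False
        then have "z' \<in> side R a y" using side_step[OF a(2) z(2)] \<open>z \<noteq> y\<close> by auto
        then show ?thesis using a by auto
      qed simp
    qed
  qed simp
qed

lemma side_children_disjoint:
  assumes "(y, a) \<in> R" "(y, b) \<in> R" "a \<noteq> b"
  shows "side R a y \<inter> side R b y = {}"
  using side_child_subset[of a y b] side_Int[of y a] assms arcD(1) by blast

lemma card_side_child: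
  assumes "(x, y) \<in> R" "(y, a) \<in> R" "a \<noteq> x"
  shows "card (side R a y) < card (side R y x)"
proof (rule psubset_card_mono)
  show "finite (side R y x)" using side_in_nodes[OF arcD(3)[OF assms(1)]] finite_nodes by (rule finite_subset)
  show "side R a y \<subset> side R y x" using side_child_subset[OF assms] side_base[of y R x] by blast
qed

end

definition deg :: "'t rel \<Rightarrow> 't \<Rightarrow> nat" where
  "deg R x = card (R `` {x})"

definition link :: "'t rel \<Rightarrow> 't \<Rightarrow> 't rel \<Rightarrow> 't \<Rightarrow> 't rel" where
  "link R1 r1 R2 r2 = R1 \<union> R2 \<union> {(r1, r2), (r2, r1)}"

lemma link_commute: "link R1 r1 R2 r2 = link R2 r2 R1 r1"
  by (auto simp: link_def)

locale linked_trees = t1: rel_tree V1 R1 + t2: rel_tree V2 R2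
  for V1 V2 :: "'t set" and R1 R2 +
  fixes r1 r2
  assumes r1: "r1 \<in> V1" and r2: "r2 \<in> V2" and disjoint: "V1 \<inter> V2 = {}"
begin

lemma swap: "linked_trees V2 V1 R2 R1 r2 r1"
  using t1.rel_tree_axioms t2.rel_tree_axioms r1 r2 disjoint
  by (simp add: linked_trees_def linked_trees_axioms_def Int_commute)

abbreviation "R \<equiv> link R1 r1 R2 r2"

lemma side_left:
  assumes xy: "(x, y) \<in> R1"
  shows "side R x y = side R1 x y \<union> (if r1 \<in> side R1 x y then V2 else {})" (is "_ = ?U")
proof
  have x: "x \<in> V1" "y \<in> V1" using xy t1.arcD by auto
  have s1: "side R1 x y \<subseteq> V1" using t1.side_in_nodes x by auto
  show "side R x y \<subseteq> ?U"
  proof (rule side_subset)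
    fix a b assume ab: "a \<in> ?U" "(a, b) \<in> R" "(a, b) \<noteq> (x, y)" "(a, b) \<noteq> (y, x)"
    consider "(a, b) \<in> R1" | "(a, b) \<in> R2" | "a = r1" "b = r2" | "a = r2" "b = r1"
      using ab(2) by (auto simp: link_def)
    then show "b \<in> ?U"
    proof cases
      case 1
      then have "a \<in> side R1 x y" using ab(1) t1.arcD(2)[OF 1] disjoint by (auto split: if_splits)
      then show ?thesis using side_step[OF _ 1] ab by auto
    next
      case 2
      then have "a \<notin> V1" using t2.arcD disjoint by auto
      then show ?thesis using ab(1) s1 t2.arcD[OF 2] by (auto split: if_splits)
    next
      case 3
      then show ?thesis using ab(1) r1 r2 disjoint by (auto split: if_splits)
    next
      case 4
      then have "a \<notin> V1" using r2 disjoint by auto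
      then show ?thesis using ab(1) s1 4 by (auto split: if_splits)
    qed
  qed (simp add: side_base)
  have "R1 - {(x, y), (y, x)} \<subseteq> R - {(x, y), (y, x)}" by (auto simp: link_def)
  then have mono: "side R1 x y \<subseteq> side R x y"
    using rtrancl_mono unfolding side_def by blast
  have "V2 \<subseteq> side R x y" if "r1 \<in> side R1 x y"
  proof
    fix z assume "z \<in> V2"
    then have "(r2, z) \<in> R2\<^sup>*" using t2.connected r2 by auto
    then have "z \<in> V2 \<inter> side R x y"
    proof (rule rtrancl_closed)
      have "r2 \<noteq> x" "r2 \<noteq> y" using x r2 disjoint by auto
      moreover have "(r1, r2) \<in> R" by (simp add: link_def)
      ultimately show "r2 \<in> V2 \<inter> side R x y" using side_step[of r1 R x y r2] that mono r2 by auto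
    next
      fix a b assume ab: "a \<in> V2 \<inter> side R x y" "(a, b) \<in> R2"
      then have "a \<noteq> x" "a \<noteq> y" "(a, b) \<in> R" using x disjoint by (auto simp: link_def)
      then show "b \<in> V2 \<inter> side R x y" using side_step[of a R x y b] ab t2.arcD by auto
    qed
    then show "z \<in> side R x y" by simp
  qed
  then show "?U \<subseteq> side R x y" using mono by auto
qed

lemma side_link: "side R r1 r2 = V1"
proof
  show "side R r1 r2 \<subseteq> V1"
  proof (rule side_subset[OF r1])
    fix a b assume ab: "a \<in> V1" "(a, b) \<in> R" "(a, b) \<noteq> (r1, r2)" "(a, b) \<noteq> (r2, r1)"
    then have "(a, b) \<in> R1" using t2.arcD disjoint by (auto simp: link_def)
    then show "b \<in> V1" using t1.arcD by auto
  qed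
  show "V1 \<subseteq> side R r1 r2"
  proof
    fix z assume "z \<in> V1"
    then have "(r1, z) \<in> R1\<^sup>*" using t1.connected r1 by auto
    then have "z \<in> V1 \<inter> side R r1 r2"
    proof (rule rtrancl_closed)
      show "r1 \<in> V1 \<inter> side R r1 r2" using r1 by (simp add: side_base)
      fix a b assume ab: "a \<in> V1 \<inter> side R r1 r2" "(a, b) \<in> R1"
      then have "(a, b) \<in> R" "a \<in> V1" "b \<in> V1" using t1.arcD by (auto simp: link_def)
      then show "b \<in> V1 \<inter> side R r1 r2"
        using side_step[of a R r1 r2 b] ab r2 disjoint by auto
    qed
    then show "z \<in> side R r1 r2" by simp
  qed
qed

lemma deg_left:
  assumes "x \<in> V1"
  shows "deg R x = deg R1 x + (if x = r1 then 1 else 0)"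
proof -
  have x: "x \<notin> V2" using assms disjoint by auto
  then have "R `` {x} = R1 `` {x} \<union> (if x = r1 then {r2} else {})"
    using r2 t2.arcD by (auto simp: link_def)
  moreover have "r2 \<notin> R1 `` {x}" using r2 disjoint by (auto dest: t1.arcD)
  moreover have "finite (R1 `` {x})"
    using t1.arcs_subset t1.finite_nodes by (metis Image_singleton_iff finite_subset subsetI t1.arcD(3))
  ultimately show ?thesis by (cases "x = r1") (auto simp: deg_def)
qed

end

context linked_trees
begin

interpretation s: linked_trees V2 V1 R2 R1 r2 r1 by (rule swap)

lemma side_right:
  assumes "(x, y) \<in> R2"
  shows "side R x y = side R2 x y \<union> (if r2 \<in> side R2 x y then V1 else {})"
  using s.side_left[OF assms] by (simp add: link_commute)

lemma side_link': "side R r2 r1 = V2"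
  using s.side_link by (simp add: link_commute)

lemma deg_right:
  assumes "x \<in> V2"
  shows "deg R x = deg R2 x + (if x = r2 then 1 else 0)"
  using s.deg_left[OF assms] by (simp add: link_commute)

lemma rel_tree_link: "rel_tree (V1 \<union> V2) R"
proof
  show "finite (V1 \<union> V2)" "V1 \<union> V2 \<noteq> {}" using t1.finite_nodes t2.finite_nodes r1 by auto
  show "R \<subseteq> (V1 \<union> V2) \<times> (V1 \<union> V2)"
    using t1.arcs_subset t2.arcs_subset r1 r2 by (auto simp: link_def)
  show sym: "sym R" using t1.sym_arcs t2.sym_arcs by (auto simp: link_def sym_def)
  show "irrefl R" using t1.irrefl_arcs t2.irrefl_arcs r1 r2 disjoint by (auto simp: link_def irrefl_def)
  have reach: "(r1, z) \<in> R\<^sup>*" if "z \<in> V1 \<union> V2" for z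
  proof -
    have "R1\<^sup>* \<subseteq> R\<^sup>*" "R2\<^sup>* \<subseteq> R\<^sup>*" by (intro rtrancl_mono; auto simp: link_def)+
    moreover have "(r1, r2) \<in> R" by (simp add: link_def)
    ultimately show ?thesis
      using that t1.connected[OF r1] t2.connected[OF r2] by (meson UnE converse_rtrancl_into_rtrancl subsetD)
  qed
  show "(x, y) \<in> R\<^sup>*" if "x \<in> V1 \<union> V2" "y \<in> V1 \<union> V2" for x y
    using reach that sym_rtrancl[OF sym] by (meson rtrancl_trans symD)
  show "y \<notin> side R x y" if xy: "(x, y) \<in> R" for x y
  proof -
    consider "(x, y) \<in> R1" | "(x, y) \<in> R2" | "x = r1" "y = r2" | "x = r2" "y = r1"
      using xy by (auto simp: link_def)
    then show ?thesis
    proof cases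
      case 1
      then show ?thesis using side_left[OF 1] t1.bridge[OF 1] t1.arcD(3)[OF 1] disjoint by auto
    next
      case 2
      then show ?thesis using side_right[OF 2] t2.bridge[OF 2] t2.arcD(3)[OF 2] disjoint by auto
    next
      case 3
      then show ?thesis using side_link r2 disjoint by auto
    next
      case 4
      then show ?thesis using side_link' r1 disjoint by auto
    qed
  qed
qed

end

lemma rel_tree_singleton: "rel_tree {r} {}"
  by unfold_locales (auto simp: sym_def irrefl_def)

lemma pcas_rtrancl: "pcas a q u \<Longrightarrow> set q \<subseteq> E \<Longrightarrow> (a, u) \<in> E\<^sup>*"
  by (induction q arbitrary: a) (auto intro: converse_rtrancl_into_rtrancl)

lemma pcas_hd_in: "pcas a q u \<Longrightarrow> u \<in> set (pawalk_verts a q)"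
  by (induction q arbitrary: a) auto

lemma fst_in_pawalk_verts: "pcas a q u \<Longrightarrow> e \<in> set q \<Longrightarrow> fst e \<in> set (pawalk_verts a q)"
  by (induction q arbitrary: a) auto

lemma distinct_pcas_last:
  "pcas a q u \<Longrightarrow> distinct (pawalk_verts a q) \<Longrightarrow> e \<in> set q \<Longrightarrow> fst e \<noteq> u"
proof (induction q arbitrary: a)
  case (Cons b q)
  then show ?case using pcas_hd_in[of "snd b" q u] by auto
qed simp

lemma rtrancl_on_iff:
  assumes "R \<subseteq> V \<times> V"
  shows "(x, y) \<in> rtrancl_on V R \<longleftrightarrow> x \<in> V \<and> (x, y) \<in> R\<^sup>*"
proof
  assume "(x, y) \<in> rtrancl_on V R"
  then show "x \<in> V \<and> (x, y) \<in> R\<^sup>*" by (meson rtrancl_on_rtranclI in_rtrancl_on_in_F(1))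
next
  assume "x \<in> V \<and> (x, y) \<in> R\<^sup>*"
  then have "(x, y) \<in> R\<^sup>*" "x \<in> V" by auto
  then show "(x, y) \<in> rtrancl_on V R"
    by (induction rule: rtrancl_induct) (use assms in \<open>auto intro: rtrancl_on_into_rtrancl_on\<close>)
qed

section \<open>Undirected trees as digraphs\<close>

lemma out_degree_eq_deg: "out_degree (with_proj T) x = deg (parcs T) x"
proof -
  have "bij_betw snd {e \<in> parcs T. fst e = x} (parcs T `` {x})"
    by (rule bij_betw_byWitness[where f' = "\<lambda>y. (x, y)"]) auto
  then show ?thesis
    by (simp add: out_degree_def out_arcs_def deg_def bij_betw_same_card)
qed

lemma mk_symmetric_pair:
  assumes "sym (parcs T)"
  shows "mk_symmetric (with_proj T) = T"
proof -
  have "(\<Union>e\<in>parcs T. {(fst e, snd e), (snd e, fst e)}) = parcs T"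
    using assms by (auto dest: symD)
  then show ?thesis by (simp add: mk_symmetric_def)
qed

lemma connected_pair_iff:
  assumes "sym (parcs T)" "parcs T \<subseteq> pverts T \<times> pverts T"
  shows "connected (with_proj T) \<longleftrightarrow>
    pverts T \<noteq> {} \<and> (\<forall>x\<in>pverts T. \<forall>y\<in>pverts T. (x, y) \<in> (parcs T)\<^sup>*)"
  using assms
  by (auto simp: connected_def mk_symmetric_pair strongly_connected_def reachable_def rtrancl_on_iff)

lemma scc_of_del_edge:
  assumes "sym (parcs T)" "parcs T \<subseteq> pverts T \<times> pverts T" "x \<in> pverts T"
  shows "pre_digraph.scc_of (with_proj (del_edge T (x, y))) x = side (parcs T) x y"
proof -
  let ?R = "parcs T - {(x, y), (y, x)}"
  have sub: "?R \<subseteq> pverts T \<times> pverts T" using assms by auto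
  have "sym ?R" using assms(1) by (auto simp: sym_def)
  then have "sym (?R\<^sup>*)" by (rule sym_rtrancl)
  moreover have "z \<in> pverts T" if "(x, z) \<in> ?R\<^sup>*" for z
    using that by (rule rtrancl_closed) (use sub assms in auto)
  ultimately show ?thesis
    using assms(3) sub
    by (auto simp: pre_digraph.scc_of_def reachable_def del_edge_def rtrancl_on_iff side_def dest: symD)
qed

lemma pair_graph_iff:
  "pair_graph T \<longleftrightarrow> finite (pverts T) \<and> parcs T \<subseteq> pverts T \<times> pverts T \<and>
     sym (parcs T) \<and> irrefl (parcs T)"
proof
  assume "pair_graph T"
  then interpret pair_graph T .
  show "finite (pverts T) \<and> parcs T \<subseteq> pverts T \<times> pverts T \<and> sym (parcs T) \<and> irrefl (parcs T)"
    using pair_finite_verts pair_sym_arcs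
    by (auto simp: irrefl_def symmetric_def dest: wellformed' pair_no_loops)
next
  assume *: "finite (pverts T) \<and> parcs T \<subseteq> pverts T \<times> pverts T \<and> sym (parcs T) \<and> irrefl (parcs T)"
  then have "finite (parcs T)" by (meson finite_SigmaI finite_subset)
  then show "pair_graph T"
    by unfold_locales (use * in \<open>auto simp: irrefl_def symmetric_def\<close>)
qed

text \<open>
  A path from x to y that avoids the edge between them closes to a cycle of length at least 3.
\<close>

lemma bridge_of_acyclic:
  assumes T: "pair_graph T" and acyclic: "\<not> (\<exists>p. pre_digraph.cycle (with_proj T) p \<and> length p \<ge> 3)"
    and xy: "(x, y) \<in> parcs T"
  shows "y \<notin> side (parcs T) x y"
proof
  assume y: "y \<in> side (parcs T) x y"
  interpret pair_graph T by fact
  let ?D = "del_edge T (x, y)"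
  have "x \<noteq> y" using pair_no_loops[OF xy] by simp
  have xV: "x \<in> pverts T" using xy by (rule in_arcsD1)
  have "parcs ?D \<subseteq> pverts ?D \<times> pverts ?D" by (auto simp: del_edge_def dest: wellformed')
  moreover have "finite (parcs ?D)" "finite (pverts ?D)" by (auto simp: del_edge_def)
  ultimately interpret D: pair_fin_digraph ?D by unfold_locales auto
  have sub: "parcs T - {(x, y), (y, x)} \<subseteq> pverts T \<times> pverts T" by (auto dest: wellformed')
  have "(x, y) \<in> rtrancl_on (pverts T) (parcs T - {(x, y), (y, x)})"
    using y xV unfolding rtrancl_on_iff[OF sub] by (simp add: side_def)
  then have "reachable (with_proj ?D) x y" by (simp add: reachable_def del_edge_def)
  then obtain p where p: "D.apath x p y" using D.reachable_apath by blast
  then have p': "set p \<subseteq> parcs ?D" "pcas x p y" "distinct (pawalk_verts x p)"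
    by (auto simp: D.apath_def D.awalk_def)
  have p_T: "set p \<subseteq> parcs T" "(x, y) \<notin> set p" using p'(1) by (auto simp: del_edge_def)
  have "p \<noteq> []" using p'(2) \<open>x \<noteq> y\<close> by auto
  moreover have "p \<noteq> [e]" for e using p'(2) p_T(2) by (cases e) auto
  ultimately have "2 \<le> length p" by (metis One_nat_def Suc_1 Suc_leI length_0_conv length_Suc_conv neq0_conv nat_less_le)
  moreover have "cycle ((y, x) # p)"
    unfolding cycle_def awalk_def
    using p' p_T graph_symmetric[OF xy] in_arcsD2[OF xy] by (intro exI[of _ y]) auto
  ultimately show False using acyclic by force
qed

text \<open>
  A cycle of length at least 3 minus its first arc is a walk that avoids this arc in both
  directions.
\<close>

lemma acyclic_of_bridges:
  assumes T: "pair_graph T" and bridges: "\<And>x y. (x, y) \<in> parcs T \<Longrightarrow> y \<notin> side (parcs T) x y"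
    and cycle: "pre_digraph.cycle (with_proj T) p" "3 \<le> length p"
  shows False
proof -
  interpret pair_graph T by fact
  obtain u where u: "u \<in> pverts T" "set p \<subseteq> parcs T" "pcas u p u" "distinct (tl (pawalk_verts u p))"
    using cycle(1) by (auto simp: cycle_def awalk_def)
  obtain a b q' where p: "p = (u, a) # (a, b) # q'" and "q' \<noteq> []"
    using u(3) cycle(2) by (cases p; cases "tl p"; cases "tl (tl p)") auto
  let ?q = "(a, b) # q'"
  have q: "pcas a ?q u" "distinct (pawalk_verts a ?q)" "set ?q \<subseteq> parcs T" using u p by auto
  have "(u, a) \<notin> set ?q" using distinct_pcas_last[OF q(1,2), of "(u, a)"] by auto
  moreover have "(a, u) \<notin> set ?q"
  proof
    assume "(a, u) \<in> set ?q"
    moreover have "(a, u) \<notin> set q'"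
      using fst_in_pawalk_verts[of b q' u "(a, u)"] q by auto
    ultimately have "b = u" by auto
    then show False
      using \<open>q' \<noteq> []\<close> distinct_pcas_last[of b q' u "hd q'"] q by (cases q') auto
  qed
  ultimately have "set ?q \<subseteq> parcs T - {(a, u), (u, a)}" using q(3) by auto
  then have "(a, u) \<in> (parcs T - {(a, u), (u, a)})\<^sup>*" using pcas_rtrancl[OF q(1)] by blast
  moreover have "(a, u) \<in> parcs T" using u p graph_symmetric[of u a] by auto
  ultimately show False using bridges[of a u] by (simp add: side_def)
qed

theorem undirected_tree_iff: "undirected_tree T \<longleftrightarrow> rel_tree (pverts T) (parcs T)"
proof
  assume T: "undirected_tree T"
  then have "pair_graph T" by (simp add: undirected_tree_def)
  then have g: "finite (pverts T)" "parcs T \<subseteq> pverts T \<times> pverts T" "sym (parcs T)" "irrefl (parcs T)"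
    by (auto simp: pair_graph_iff)
  show "rel_tree (pverts T) (parcs T)"
  proof
    show "(x, y) \<in> (parcs T)\<^sup>*" if "x \<in> pverts T" "y \<in> pverts T" for x y
      using T g that by (auto simp: undirected_tree_def connected_pair_iff)
    show "pverts T \<noteq> {}" using T g by (auto simp: undirected_tree_def connected_pair_iff)
    show "y \<notin> side (parcs T) x y" if "(x, y) \<in> parcs T" for x y
      using T bridge_of_acyclic[OF _ _ that] by (simp add: undirected_tree_def)
  qed (use g in auto)
next
  assume "rel_tree (pverts T) (parcs T)"
  then interpret rel_tree "pverts T" "parcs T" .
  have g: "pair_graph T"
    using finite_nodes arcs_subset sym_arcs irrefl_arcs by (simp add: pair_graph_iff)
  then show "undirected_tree T"
    using acyclic_of_bridges[OF g bridge] connected nonempty sym_arcs arcs_subset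
    by (auto simp: undirected_tree_def connected_pair_iff)
qed

section \<open>Tree layouts of branched sets\<close>

definition leaves_below :: "('a \<Rightarrow> 't) \<Rightarrow> 'a set \<Rightarrow> 't set \<Rightarrow> 'a set" where
  "leaves_below \<mu> S C = {v \<in> S. \<mu> v \<in> C}"

text \<open>
  For every edge, the leaves on one of its sides form a branched set, by induction on the size of
  the side. The two sides of any edge then make up S.
\<close>

lemma (in rel_tree) branched_of_layout:
  assumes deg: "\<And>x. x \<in> V \<Longrightarrow> deg R x = 1 \<or> deg R x = 3"
    and \<mu>: "bij_betw \<mu> S {x \<in> V. deg R x = 1}"
    and width: "\<And>x y. (x, y) \<in> R \<Longrightarrow> f (leaves_below \<mu> S (side R x y)) \<le> k"
    and S: "f S \<le> k" "2 \<le> card S"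
  shows "branched f k S"
proof -
  have br: "branched f k (leaves_below \<mu> S (side R y x))" if "(x, y) \<in> R" for x y
    using that
  proof (induction "card (side R y x)" arbitrary: x y rule: less_induct)
    case less
    have x: "x \<in> R `` {y}" "y \<in> V" using arcD[OF less.prems] by auto
    have le: "f (leaves_below \<mu> S (side R y x)) \<le> k" using width arcD(1)[OF less.prems] .
    have eq: "side R y x = insert y (\<Union>a\<in>R `` {y} - {x}. side R a y)"
      using side_eq_children[OF less.prems] .
    from deg[OF x(2)] show ?case
    proof
      assume d: "deg R y = 1"
      then obtain x' where "R `` {y} = {x'}" unfolding deg_def by (auto simp: card_1_singleton_iff)
      then have "side R y x = {y}" using eq x by auto
      moreover have "y \<in> \<mu> ` S" using \<mu> d x(2) by (simp add: bij_betw_def)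
      then obtain v where "v \<in> S" "\<mu> v = y" by blast
      moreover have "inj_on \<mu> S" using \<mu> by (simp add: bij_betw_def)
      ultimately have "leaves_below \<mu> S (side R y x) = {v}"
        by (auto simp: leaves_below_def dest: inj_onD)
      then show ?thesis using le by (simp add: branched.leaf)
    next
      assume d: "deg R y = 3"
      then have "card (R `` {y} - {x}) = 2" using x unfolding deg_def by (simp add: card_Diff_singleton)
      then obtain a b where ab: "R `` {y} - {x} = {a, b}" "a \<noteq> b" by (auto simp: card_2_iff)
      then have arcs: "(y, a) \<in> R" "(y, b) \<in> R" "a \<noteq> x" "b \<noteq> x" by auto
      have sub: "branched f k (leaves_below \<mu> S (side R c y))" if "c \<in> {a, b}" for c
        using that arcs card_side_child[OF less.prems] by (intro less.hyps) auto
      have "\<mu> v \<noteq> y" if "v \<in> S" for v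
        using bij_betw_apply[OF \<mu> that] d by auto
      then have split: "leaves_below \<mu> S (side R y x) =
          leaves_below \<mu> S (side R a y) \<union> leaves_below \<mu> S (side R b y)"
        unfolding eq ab(1) by (auto simp: leaves_below_def)
      have "leaves_below \<mu> S (side R a y) \<inter> leaves_below \<mu> S (side R b y) = {}"
        using side_children_disjoint[OF arcs(1,2) ab(2)] by (auto simp: leaves_below_def)
      then show ?thesis using sub le unfolding split by (intro branched.join) auto
    qed
  qed
  have "S \<noteq> {}" using S(2) by auto
  then obtain v where "\<mu> v \<in> V" "deg R (\<mu> v) = 1" using \<mu> by (auto simp: bij_betw_def)
  then obtain y where xy: "(\<mu> v, y) \<in> R" by (auto simp: deg_def card_1_singleton_iff)
  let ?x = "\<mu> v"
  have "S = leaves_below \<mu> S (side R ?x y) \<union> leaves_below \<mu> S (side R y ?x)"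
    using side_Un[OF xy] \<mu> by (auto simp: leaves_below_def bij_betw_def)
  moreover have "leaves_below \<mu> S (side R ?x y) \<inter> leaves_below \<mu> S (side R y ?x) = {}"
    using side_Int[OF xy] by (auto simp: leaves_below_def)
  ultimately show ?thesis using br[OF xy] br[OF arcD(1)[OF xy]] S(1) by (metis branched.join)
qed

text \<open>
  A layout of S on a tree with a root r that still waits for an edge to its parent; this is why r
  counts with one more than its degree. The width of an edge is only known on the side away from
  the root, so for the other side it is stated for the complement within S.
\<close>

locale rooted_layout = rel_tree V R for V :: "'t set" and R +
  fixes r :: 't and \<mu> :: "'a \<Rightarrow> 't" and S :: "'a set" and f :: "'a set \<Rightarrow> nat" and k :: nat
  assumes root: "r \<in> V"
    and layout: "bij_betw \<mu> S {x \<in> V. deg R x + (if x = r then 1 else 0) = 1}"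
    and degrees: "x \<in> V \<Longrightarrow> deg R x + (if x = r then 1 else 0) \<in> {1, 3}"
    and width_away: "(x, y) \<in> R \<Longrightarrow> r \<notin> side R x y \<Longrightarrow> f (leaves_below \<mu> S (side R x y)) \<le> k"
    and width_toward: "(x, y) \<in> R \<Longrightarrow> r \<in> side R x y \<Longrightarrow>
      f (S - leaves_below \<mu> S (side R x y)) \<le> k"
    and width_all: "f S \<le> k"
begin

lemma layout_in: "v \<in> S \<Longrightarrow> \<mu> v \<in> V"
  using layout by (auto simp: bij_betw_def)

end

locale two_layouts =
  l1: rooted_layout V1 R1 r1 \<mu>1 S1 f k + l2: rooted_layout V2 R2 r2 \<mu>2 S2 f k
  for V1 V2 :: "'t set" and R1 R2 r1 r2 and \<mu>1 \<mu>2 :: "'a \<Rightarrow> 't" and S1 S2 f k +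
  assumes nodes_disjoint: "V1 \<inter> V2 = {}" and leaves_disjoint: "S1 \<inter> S2 = {}"
begin

definition both :: "'a \<Rightarrow> 't" where
  "both v = (if v \<in> S1 then \<mu>1 v else \<mu>2 v)"

lemma both_right: "v \<in> S2 \<Longrightarrow> both v = \<mu>2 v"
  using leaves_disjoint by (auto simp: both_def)

lemma bij_both:
  assumes "A \<inter> B = {}" "bij_betw \<mu>1 S1 A" "bij_betw \<mu>2 S2 B"
  shows "bij_betw both (S1 \<union> S2) (A \<union> B)"
proof (rule bij_betw_combine)
  show "bij_betw both S1 A" using assms(2) by (rule bij_betw_cong[THEN iffD1, rotated]) (simp add: both_def)
  show "bij_betw both S2 B" using assms(3) by (rule bij_betw_cong[THEN iffD1, rotated]) (simp add: both_right)
qed (use assms in auto)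

lemma leaves_below_both:
  "C \<subseteq> V1 \<Longrightarrow> leaves_below both (S1 \<union> S2) C = leaves_below \<mu>1 S1 C"
  "C \<subseteq> V1 \<Longrightarrow> leaves_below both (S1 \<union> S2) (C \<union> V2) = leaves_below \<mu>1 S1 C \<union> S2"
  "C \<subseteq> V2 \<Longrightarrow> leaves_below both (S1 \<union> S2) C = leaves_below \<mu>2 S2 C"
  "C \<subseteq> V2 \<Longrightarrow> leaves_below both (S1 \<union> S2) (C \<union> V1) = leaves_below \<mu>2 S2 C \<union> S1"
  using nodes_disjoint leaves_disjoint l1.layout_in l2.layout_in both_right
  by (auto simp: leaves_below_def both_def)

sublocale linked_trees V1 V2 R1 R2 r1 r2
  using l1.rel_tree_axioms l2.rel_tree_axioms l1.root l2.root nodes_disjoint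
  by (simp add: linked_trees_def linked_trees_axioms_def)

lemma deg_link_cases:
  assumes "x \<in> V1 \<union> V2"
  shows "deg (link R1 r1 R2 r2) x \<in> {1, 3}"
    and "deg (link R1 r1 R2 r2) x = 1 \<longleftrightarrow>
      x \<in> V1 \<and> deg R1 x + (if x = r1 then 1 else 0) = 1 \<or>
      x \<in> V2 \<and> deg R2 x + (if x = r2 then 1 else 0) = 1"
  using assms deg_left[of x] deg_right[of x] l1.degrees[of x] l2.degrees[of x] nodes_disjoint by auto

lemma bij_link:
  "bij_betw both (S1 \<union> S2) {x \<in> V1 \<union> V2. deg (link R1 r1 R2 r2) x = 1}"
proof -
  have "{x \<in> V1 \<union> V2. deg (link R1 r1 R2 r2) x = 1} =
    {x \<in> V1. deg R1 x + (if x = r1 then 1 else 0) = 1} \<union>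
    {x \<in> V2. deg R2 x + (if x = r2 then 1 else 0) = 1}"
    using deg_link_cases(2) by blast
  then show ?thesis
    using bij_both[OF _ l1.layout l2.layout] nodes_disjoint by (simp add: disjoint_iff)
qed

text \<open>
  The new edge replaces the two edges that the roots r1 and r2 were waiting for. The width of an
  edge is bounded on one of its two sides, the one that does not contain the other tree.
\<close>

lemma width_link:
  assumes xy: "(x, y) \<in> link R1 r1 R2 r2"
  shows "f (leaves_below both (S1 \<union> S2) (side (link R1 r1 R2 r2) x y)) \<le> k \<or>
    f (S1 \<union> S2 - leaves_below both (S1 \<union> S2) (side (link R1 r1 R2 r2) x y)) \<le> k"
proof -
  have all: "leaves_below \<mu>1 S1 V1 = S1" "leaves_below \<mu>2 S2 V2 = S2"
    using l1.layout_in l2.layout_in by (auto simp: leaves_below_def)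
  have diff: "S1 \<union> S2 - (leaves_below \<mu>1 S1 C \<union> S2) = S1 - leaves_below \<mu>1 S1 C"
    "S1 \<union> S2 - (leaves_below \<mu>2 S2 C \<union> S1) = S2 - leaves_below \<mu>2 S2 C" for C
    using leaves_disjoint by (auto simp: leaves_below_def)
  consider "(x, y) \<in> R1" | "(x, y) \<in> R2" | "x = r1" "y = r2" | "x = r2" "y = r1"
    using xy by (auto simp: link_def)
  then show ?thesis
  proof cases
    case 1
    have "side R1 x y \<subseteq> V1" using l1.side_in_nodes l1.arcD(2)[OF 1] .
    then show ?thesis
      using side_left[OF 1] l1.width_away[OF 1] l1.width_toward[OF 1]
      by (auto simp: leaves_below_both diff)
  next
    case 2
    have "side R2 x y \<subseteq> V2" using l2.side_in_nodes l2.arcD(2)[OF 2] .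
    then show ?thesis
      using side_right[OF 2] l2.width_away[OF 2] l2.width_toward[OF 2]
      by (auto simp: leaves_below_both diff)
  next
    case 3
    then show ?thesis using side_link leaves_below_both(1)[of V1] all l1.width_all by simp
  next
    case 4
    then show ?thesis using side_link' leaves_below_both(3)[of V2] all l2.width_all by simp
  qed
qed

text \<open>
  Both trees are attached to a new root r, which is thereby given degree 2.
\<close>

lemma rooted_layout_join:
  assumes r: "r \<notin> V1" "r \<notin> V2" and le: "f (S1 \<union> S2) \<le> k"
  shows "rooted_layout (insert r (V1 \<union> V2)) (link (link R1 r1 {} r) r R2 r2) r both (S1 \<union> S2) f k"
proof -
  interpret a: linked_trees V1 "{r}" R1 "{}" r1 r
    using l1.rel_tree_axioms rel_tree_singleton[of r] l1.root r
    by (simp add: linked_trees_def linked_trees_axioms_def)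
  interpret b: linked_trees "V1 \<union> {r}" V2 "link R1 r1 {} r" R2 r r2
    using a.rel_tree_link l2.rel_tree_axioms l2.root r nodes_disjoint
    by (simp add: linked_trees_def linked_trees_axioms_def Int_Un_distrib2)
  let ?V = "insert r (V1 \<union> V2)" and ?R = "link (link R1 r1 {} r) r R2 r2"
  have deg: "deg ?R x = deg R1 x + (if x = r1 then 1 else 0)" if "x \<in> V1" for x
    using that a.deg_left[of x] b.deg_left[of x] r by auto
  have deg': "deg ?R x = deg R2 x + (if x = r2 then 1 else 0)" if "x \<in> V2" for x
    using that b.deg_right[of x] by auto
  have degr: "deg ?R r = 2"
    using a.deg_right[of r] b.deg_left[of r] by (simp add: deg_def)
  have all: "leaves_below \<mu>1 S1 V1 = S1" "leaves_below \<mu>2 S2 V2 = S2"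
    using l1.layout_in l2.layout_in by (auto simp: leaves_below_def)
  have drop_r: "leaves_below both (S1 \<union> S2) (insert r C) = leaves_below both (S1 \<union> S2) C" for C
  proof -
    have "both v \<noteq> r" if "v \<in> S1 \<union> S2" for v
      using that r l1.layout_in[of v] l2.layout_in[of v] by (auto simp: both_def)
    then show ?thesis by (auto simp: leaves_below_def)
  qed
  have diff: "S1 \<union> S2 - (leaves_below \<mu>1 S1 C \<union> S2) = S1 - leaves_below \<mu>1 S1 C"
    "S1 \<union> S2 - (leaves_below \<mu>2 S2 C \<union> S1) = S2 - leaves_below \<mu>2 S2 C"
    "S1 \<union> S2 - S2 = S1" "S1 \<union> S2 - S1 = S2" for C
    using leaves_disjoint by (auto simp: leaves_below_def)
  have leaves: "{x \<in> ?V. deg ?R x + (if x = r then 1 else 0) = 1} =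
    {x \<in> V1. deg R1 x + (if x = r1 then 1 else 0) = 1} \<union>
    {x \<in> V2. deg R2 x + (if x = r2 then 1 else 0) = 1}"
    using deg deg' degr r by auto
  have widths: "(r \<notin> side ?R x y \<longrightarrow> f (leaves_below both (S1 \<union> S2) (side ?R x y)) \<le> k) \<and>
      (r \<in> side ?R x y \<longrightarrow> f (S1 \<union> S2 - leaves_below both (S1 \<union> S2) (side ?R x y)) \<le> k)"
    if xy: "(x, y) \<in> ?R" for x y
  proof -
    consider "(x, y) \<in> R1" | "(x, y) \<in> R2" | "x = r1" "y = r" | "x = r" "y = r1"
      | "x = r" "y = r2" | "x = r2" "y = r"
      using xy by (auto simp: link_def)
    then show ?thesis
    proof cases
      case 1
      have sub: "side R1 x y \<subseteq> V1" using l1.side_in_nodes l1.arcD(2)[OF 1] .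
      have "(x, y) \<in> link R1 r1 {} r" using 1 by (simp add: link_def)
      then have "side ?R x y = side R1 x y \<union> (if r1 \<in> side R1 x y then insert r V2 else {})"
        using a.side_left[OF 1] b.side_left[of x y] sub r by (auto split: if_splits)
      then show ?thesis
        using l1.width_away[OF 1] l1.width_toward[OF 1] sub r
        by (auto simp: leaves_below_both diff drop_r)
    next
      case 2
      have sub: "side R2 x y \<subseteq> V2" using l2.side_in_nodes l2.arcD(2)[OF 2] .
      have "side ?R x y = side R2 x y \<union> (if r2 \<in> side R2 x y then insert r V1 else {})"
        using b.side_right[OF 2] by auto
      then show ?thesis
        using l2.width_away[OF 2] l2.width_toward[OF 2] sub r
        by (auto simp: leaves_below_both diff drop_r)
    next
      case 3
      then have "(x, y) \<in> link R1 r1 {} r" by (simp add: link_def)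
      then have "side ?R x y = V1" using a.side_link b.side_left[of x y] 3 r by auto
      then show ?thesis using r leaves_below_both(1)[of V1] all l1.width_all by simp
    next
      case 4
      then have "(x, y) \<in> link R1 r1 {} r" by (simp add: link_def)
      then have "side ?R x y = insert r V2" using a.side_link' b.side_left[of x y] 4 r by auto
      then show ?thesis using leaves_below_both(3)[of V2] all l1.width_all drop_r diff by simp
    next
      case 5
      then have "side ?R x y = insert r V1" using b.side_link by auto
      then show ?thesis using leaves_below_both(1)[of V1] all l2.width_all drop_r diff by simp
    next
      case 6
      then have "side ?R x y = V2" using b.side_link' by auto
      then show ?thesis using r leaves_below_both(3)[of V2] all l2.width_all by simp
    qed
  qed
  have tree: "rel_tree ?V ?R" using b.rel_tree_link by (simp add: insert_commute)
  show ?thesis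
    unfolding rooted_layout_def rooted_layout_axioms_def leaves
  proof (intro conjI allI impI tree)
    show "bij_betw both (S1 \<union> S2) ({x \<in> V1. deg R1 x + (if x = r1 then 1 else 0) = 1} \<union>
        {x \<in> V2. deg R2 x + (if x = r2 then 1 else 0) = 1})"
      using bij_both[OF _ l1.layout l2.layout] nodes_disjoint by (simp add: disjoint_iff)
    show "deg ?R x + (if x = r then 1 else 0) \<in> {1, 3}" if "x \<in> ?V" for x
      using that deg deg' degr r l1.degrees[of x] l2.degrees[of x] by auto
  qed (use widths le in auto)
qed

end

lemma rooted_layout_leaf:
  assumes "f {v} \<le> k"
  shows "rooted_layout {n} {} n (\<lambda>_. n) {v} f k"
  using assms rel_tree_singleton[of n]
  by (auto simp: rooted_layout_def rooted_layout_axioms_def deg_def bij_betw_def)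

lemma two_layoutsI:
  assumes "rooted_layout V1 R1 r1 \<mu>1 S1 f k" "rooted_layout V2 R2 r2 \<mu>2 S2 f k"
    "V1 \<subseteq> {n..}" "V2 \<subseteq> {Suc (Max V1)..}" "S1 \<inter> S2 = {}"
  shows "two_layouts V1 V2 R1 R2 r1 r2 \<mu>1 \<mu>2 S1 S2 f k"
proof -
  interpret l1: rooted_layout V1 R1 r1 \<mu>1 S1 f k by fact
  have "x \<le> Max V1" if "x \<in> V1" for x using l1.finite_nodes that by simp
  then have "V1 \<inter> V2 = {}" using assms(4) by fastforce
  then show ?thesis using assms by (simp add: two_layouts_def two_layouts_axioms_def)
qed

text \<open>
  The nodes of the second tree are chosen above those of the first, and the new root above both,
  to keep them apart.
\<close>

lemma rooted_layout_of_branched: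
  assumes "branched f k S"
  shows "\<exists>V R r \<mu>. rooted_layout V R r \<mu> S f k \<and> V \<subseteq> {n :: nat..}"
  using assms
proof (induction arbitrary: n rule: branched.induct)
  case (leaf v)
  then show ?case using rooted_layout_leaf[of f v k n] by blast
next
  case (join S1 S2)
  obtain V1 R1 r1 \<mu>1 where 1: "rooted_layout V1 R1 r1 \<mu>1 S1 f k" "V1 \<subseteq> {n..}"
    using join.IH(1) by blast
  obtain V2 R2 r2 \<mu>2 where 2: "rooted_layout V2 R2 r2 \<mu>2 S2 f k" "V2 \<subseteq> {Suc (Max V1)..}"
    using join.IH(2) by blast
  interpret two_layouts V1 V2 R1 R2 r1 r2 \<mu>1 \<mu>2 S1 S2 f k
    using two_layoutsI 1 2 join.hyps(3) by blast
  define r where "r = Suc (Max (V1 \<union> V2))"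
  have fin: "finite (V1 \<union> V2)" using l1.finite_nodes l2.finite_nodes by simp
  have "x < r" if "x \<in> V1 \<union> V2" for x using Max_ge[OF fin that] by (simp add: r_def)
  then have r: "r \<notin> V1" "r \<notin> V2" "n \<le> r" using 1(2) l1.root by fastforce+
  have "n \<le> Max V1" using 1(2) l1.root l1.finite_nodes by (meson Max_ge atLeast_iff le_trans subsetD)
  then have "insert r (V1 \<union> V2) \<subseteq> {n..}" using 1(2) 2(2) r(3) by auto
  then show ?case using rooted_layout_join[OF r(1,2) join.hyps(4)] by blast
qed

lemma layout_of_branched:
  assumes "branched f k S" "2 \<le> card S"
  obtains V :: "nat set" and R \<mu> where "rel_tree V R" "\<And>x. x \<in> V \<Longrightarrow> deg R x = 1 \<or> deg R x = 3"
    "bij_betw \<mu> S {x \<in> V. deg R x = 1}"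
    "\<And>x y. (x, y) \<in> R \<Longrightarrow> f (leaves_below \<mu> S (side R x y)) \<le> k \<or>
       f (S - leaves_below \<mu> S (side R x y)) \<le> k"
  using assms(1)
proof cases
  case (leaf v)
  then show ?thesis using assms(2) by simp
next
  case (join S1 S2)
  obtain V1 :: "nat set" and R1 r1 \<mu>1 where 1: "rooted_layout V1 R1 r1 \<mu>1 S1 f k" "V1 \<subseteq> {0..}"
    using rooted_layout_of_branched[OF join(2)] by blast
  obtain V2 :: "nat set" and R2 r2 \<mu>2 where
    2: "rooted_layout V2 R2 r2 \<mu>2 S2 f k" "V2 \<subseteq> {Suc (Max V1)..}"
    using rooted_layout_of_branched[OF join(3)] by blast
  interpret two_layouts V1 V2 R1 R2 r1 r2 \<mu>1 \<mu>2 S1 S2 f k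
    using two_layoutsI 1 2 join(4) by blast
  show ?thesis
    using that[OF rel_tree_link _ bij_link[folded join(1)]] deg_link_cases(1) width_link join(1) by auto
qed

section \<open>Cut-rank as a connectivity function\<close>

definition adj :: "'a pair_pre_digraph \<Rightarrow> 'a \<Rightarrow> 'a \<Rightarrow> bit" where
  "adj G x y = (if (x, y) \<in> parcs G then 1 else 0)"

lemma cut_rank_eq_rank_on: "cut_rank G X = rank_on (adj G) X (pverts G - X)"
  unfolding cut_rank_def rank_on_def
  by (rule arg_cong[where f = gf2.dim], rule image_cong)
    (auto simp: cut_row_def row_on_def adj_def fun_eq_iff)

lemma rank_on_symmetric:
  assumes "finite X" "finite Y" "\<And>x y. M x y = M y x"
  shows "rank_on M X Y = rank_on M Y X"
  using rank_on_transpose[OF assms(1,2), of M] rank_on_cong[of Y X "\<lambda>y x. M x y" M] assms(3) by simp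

lemma connectivity_rank_on:
  assumes V: "finite V" and sym: "\<And>x y. M x y = M y x"
  shows "connectivity V (\<lambda>X. rank_on M X (V - X))"
proof
  fix X assume X: "X \<subseteq> V"
  then have "V - (V - X) = X" by auto
  moreover have "finite X" using X V finite_subset by blast
  ultimately show "rank_on M (V - X) (V - (V - X)) = rank_on M X (V - X)"
    using rank_on_symmetric[of "V - X" X M] sym V by simp
next
  fix X Y assume XY: "X \<subseteq> V" "Y \<subseteq> V"
  then have "finite X" "finite Y" using V finite_subset by auto
  then have "rank_on M (X \<union> Y) ((V - X) \<inter> (V - Y)) + rank_on M (X \<inter> Y) ((V - X) \<union> (V - Y))
      \<le> rank_on M X (V - X) + rank_on M Y (V - Y)"
    by (rule rank_on_submodular)
  moreover have "(V - X) \<inter> (V - Y) = V - (X \<union> Y)" "(V - X) \<union> (V - Y) = V - X \<inter> Y" by auto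
  ultimately show "rank_on M (X \<union> Y) (V - (X \<union> Y)) + rank_on M (X \<inter> Y) (V - X \<inter> Y)
      \<le> rank_on M X (V - X) + rank_on M Y (V - Y)"
    by simp
qed (use V in auto)

lemma adj_symmetric: "sym (parcs G) \<Longrightarrow> adj G x y = adj G y x"
  by (auto simp: adj_def dest: symD)

lemma connectivity_cut_rank:
  assumes "pair_graph G"
  shows "connectivity (pverts G) (cut_rank G)"
proof -
  have "cut_rank G = (\<lambda>X. rank_on (adj G) X (pverts G - X))" by (rule ext) (rule cut_rank_eq_rank_on)
  moreover have "adj G x y = adj G y x" for x y
    using assms by (intro adj_symmetric) (simp add: pair_graph_iff)
  ultimately show ?thesis
    using assms connectivity_rank_on[of "pverts G" "adj G"] by (simp add: pair_graph_iff)
qed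

section \<open>Rank-width and branched sets\<close>

lemma edge_width_eq:
  assumes "pair_graph T" "(x, y) \<in> parcs T"
  shows "edge_width G T \<mu> (x, y) = cut_rank G (leaves_below \<mu> (pverts G) (side (parcs T) x y))"
  using assms scc_of_del_edge[of T x y]
  by (auto simp: edge_width_def leaves_below_def pair_graph_iff)

lemma rank_decomposition_iff:
  "rank_decomposition G T \<mu> \<longleftrightarrow> rel_tree (pverts T) (parcs T) \<and>
     (\<forall>x\<in>pverts T. deg (parcs T) x = 1 \<or> deg (parcs T) x = 3) \<and>
     bij_betw \<mu> (pverts G) {x \<in> pverts T. deg (parcs T) x = 1}"
  by (simp add: rank_decomposition_def subcubic_tree_def undirected_tree_iff leaves_def out_degree_eq_deg)

lemma decomposition_of_branched:
  assumes G: "pair_graph G" and br: "branched (cut_rank G) k (pverts G)" and card: "2 \<le> card (pverts G)"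
  shows "\<exists>(T :: nat pair_pre_digraph) \<mu>. rank_decomposition G T \<mu> \<and> decomposition_width G T \<mu> \<le> k"
proof -
  interpret connectivity "pverts G" "cut_rank G" using G by (rule connectivity_cut_rank)
  let ?S = "pverts G"
  obtain V :: "nat set" and R \<mu> where l: "rel_tree V R" "\<And>x. x \<in> V \<Longrightarrow> deg R x = 1 \<or> deg R x = 3"
    "bij_betw \<mu> ?S {x \<in> V. deg R x = 1}"
    "\<And>x y. (x, y) \<in> R \<Longrightarrow> cut_rank G (leaves_below \<mu> ?S (side R x y)) \<le> k \<or>
       cut_rank G (?S - leaves_below \<mu> ?S (side R x y)) \<le> k"
    using layout_of_branched[OF br card] by blast
  define T where "T = \<lparr>pverts = V, parcs = R\<rparr>"
  interpret rel_tree V R by fact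
  have T: "rank_decomposition G T \<mu>" using l by (simp add: rank_decomposition_iff T_def)
  have pg: "pair_graph T"
    using finite_nodes arcs_subset sym_arcs irrefl_arcs by (simp add: pair_graph_iff T_def)
  have fin: "finite R" using arcs_subset finite_nodes by (meson finite_SigmaI finite_subset)
  obtain v where "v \<in> ?S" using card by fastforce
  then have "deg R (\<mu> v) = 1" using bij_betw_apply[OF l(3)] by auto
  then have ne: "R \<noteq> {}" by (auto simp: deg_def)
  have "edge_width G T \<mu> e \<le> k" if e: "e \<in> R" for e
  proof -
    obtain x y where xy: "e = (x, y)" by (cases e)
    have "leaves_below \<mu> ?S (side R x y) \<subseteq> ?S" by (auto simp: leaves_below_def)
    then have "cut_rank G (leaves_below \<mu> ?S (side R x y)) \<le> k"
      using l(4)[of x y] e xy symmetric by auto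
    then show ?thesis using edge_width_eq[OF pg, of x y G \<mu>] e xy by (simp add: T_def)
  qed
  then have "decomposition_width G T \<mu> \<le> k"
    using fin ne by (simp add: decomposition_width_def T_def)
  then show ?thesis using T by blast
qed

lemma branched_of_decomposition:
  assumes G: "pair_graph G" and T: "rank_decomposition G T \<mu>" and w: "decomposition_width G T \<mu> \<le> k"
    and card: "2 \<le> card (pverts G)"
  shows "branched (cut_rank G) k (pverts G)"
proof -
  interpret connectivity "pverts G" "cut_rank G" using G by (rule connectivity_cut_rank)
  have pg: "pair_graph T"
    using T by (simp add: rank_decomposition_def subcubic_tree_def undirected_tree_def)
  interpret rel_tree "pverts T" "parcs T" using T by (simp add: rank_decomposition_iff)
  have fin: "finite (parcs T)" using arcs_subset finite_nodes by (meson finite_SigmaI finite_subset)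
  show ?thesis
  proof (rule branched_of_layout)
    show "deg (parcs T) x = 1 \<or> deg (parcs T) x = 3" if "x \<in> pverts T" for x
      using T that by (simp add: rank_decomposition_iff)
    show "bij_betw \<mu> (pverts G) {x \<in> pverts T. deg (parcs T) x = 1}"
      using T by (simp add: rank_decomposition_iff)
    show "cut_rank G (leaves_below \<mu> (pverts G) (side (parcs T) x y)) \<le> k"
      if xy: "(x, y) \<in> parcs T" for x y
    proof -
      have "edge_width G T \<mu> (x, y) \<le> decomposition_width G T \<mu>"
        unfolding decomposition_width_def using fin xy by (intro Max_ge) auto
      then show ?thesis using edge_width_eq[OF pg xy, of G \<mu>] w by linarith
    qed
  qed (use ground card in auto)
qed

theorem rank_width_le_iff:
  assumes G: "pair_graph G" and card: "2 \<le> card (pverts G)"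
  shows "rank_width G \<le> k \<longleftrightarrow> branched (cut_rank G) k (pverts G)"
proof -
  let ?P = "\<lambda>r. \<exists>(T :: nat pair_pre_digraph) \<mu>. rank_decomposition G T \<mu> \<and> decomposition_width G T \<mu> = r"
  have rw: "rank_width G = (LEAST r. ?P r)" using card by (simp add: rank_width_def)
  show ?thesis
  proof
    assume le: "rank_width G \<le> k"
    have fin: "finite (pverts G)" using G by (simp add: pair_graph_iff)
    (* A decomposition of unrestricted width exists, so the least width is attained. *)
    have "branched (cut_rank G) (Max (cut_rank G ` Pow (pverts G))) (pverts G)"
      using fin card by (intro branched_bounded Max_ge) auto
    then have "\<exists>r. ?P r" using decomposition_of_branched[OF G _ card] by blast
    then have "?P (rank_width G)" unfolding rw by (rule LeastI_ex)
    then show "branched (cut_rank G) k (pverts G)"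
      using branched_of_decomposition[OF G _ _ card] le by metis
  next
    assume "branched (cut_rank G) k (pverts G)"
    then obtain T :: "nat pair_pre_digraph" and \<mu> where
      T: "rank_decomposition G T \<mu>" "decomposition_width G T \<mu> \<le> k"
      using decomposition_of_branched[OF G _ card] by blast
    have "rank_width G \<le> decomposition_width G T \<mu>"
      unfolding rw using T(1) by (intro Least_le) blast
    then show "rank_width G \<le> k" using T(2) by simp
  qed
qed

lemma branched_of_rank_width:
  assumes G: "pair_graph G" and le: "rank_width G \<le> k" and ne: "pverts G \<noteq> {}"
  shows "branched (cut_rank G) k (pverts G)"
proof (cases "2 \<le> card (pverts G)")
  case True
  then show ?thesis using rank_width_le_iff[OF G] le by blast
next
  case False
  interpret connectivity "pverts G" "cut_rank G" using G by (rule connectivity_cut_rank)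
  have "card (pverts G) = 1" using False ne finite_ground by (metis One_nat_def Suc_1 Suc_leI card_gt_0_iff le_neq_implies_less)
  then obtain v where "pverts G = {v}" by (auto simp: card_1_singleton_iff)
  then show ?thesis using ground branched.leaf[of "cut_rank G" v k] by simp
qed

section \<open>Deleting a vertex, with or without a pivot\<close>

definition delete_vertex :: "'a pair_pre_digraph \<Rightarrow> 'a \<Rightarrow> 'a pair_pre_digraph" where
  "delete_vertex G v = \<lparr>pverts = pverts G - {v}, parcs = parcs G \<inter> (- {v}) \<times> (- {v})\<rparr>"

lemma pair_graph_delete_vertex: "pair_graph G \<Longrightarrow> pair_graph (delete_vertex G v)"
  unfolding pair_graph_iff by (auto simp: delete_vertex_def sym_def irrefl_def)

lemma induced_subgraph_delete_vertex:
  assumes "pair_graph G"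
  shows "induced_subgraph (with_proj (delete_vertex G v)) (with_proj G)"
proof -
  interpret G: pair_graph G by fact
  interpret D: pair_graph "delete_vertex G v" using assms by (rule pair_graph_delete_vertex)
  have "wf_digraph (with_proj G)" "wf_digraph (with_proj (delete_vertex G v))" by unfold_locales
  then show ?thesis
    using G.wellformed'
    by (auto simp: induced_subgraph_def subgraph_def delete_vertex_def)
qed

lemma pverts_pivot [simp]: "pverts (pivot G v w) = pverts G"
  by (simp add: pivot_def Let_def)

definition toggled :: "'a pair_pre_digraph \<Rightarrow> 'a \<Rightarrow> 'a \<Rightarrow> 'a rel" where
  "toggled G v w =
    (let S1 = nbhd G v - nbhd G w - {w}; S2 = nbhd G w - nbhd G v - {v}; S3 = nbhd G v \<inter> nbhd G w;
         P = S1 \<times> S2 \<union> S1 \<times> S3 \<union> S2 \<times> S3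
     in P \<union> P\<inverse>)"

lemma parcs_pivot_iff:
  fixes v w defines "s \<equiv> Transposition.transpose v w"
  shows "(x, y) \<in> parcs (pivot G v w) \<longleftrightarrow> ((s x, s y) \<in> parcs G) \<noteq> ((s x, s y) \<in> toggled G v w)"
proof -
  have mem: "(x, y) \<in> map_prod s s ` A \<longleftrightarrow> (s x, s y) \<in> A" for A
  proof
    assume "(s x, s y) \<in> A"
    then have "map_prod s s (s x, s y) \<in> map_prod s s ` A" by (rule imageI)
    then show "(x, y) \<in> map_prod s s ` A" by (simp add: s_def)
  qed (auto simp: s_def)
  have eq: "parcs (pivot G v w) = map_prod s s ` sym_diff (parcs G) (toggled G v w)"
    by (simp add: pivot_def toggled_def Let_def s_def)
  show ?thesis unfolding eq mem by auto
qed

text \<open>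
  Two vertices lie in different ones of the three sets if and only if their adjacency vectors with
  respect to v and w are nonzero and distinct. Over GF(2) this says that the 2 by 2 determinant of
  the two vectors is 1.
\<close>

lemma toggled_iff:
  assumes "x \<noteq> v" "x \<noteq> w" "y \<noteq> v" "y \<noteq> w"
  shows "(x, y) \<in> toggled G v w \<longleftrightarrow>
    ((v, x) \<in> parcs G \<and> (w, y) \<in> parcs G) \<noteq> ((w, x) \<in> parcs G \<and> (v, y) \<in> parcs G)"
  using assms unfolding toggled_def Let_def nbhd_def
  by (cases "(v, x) \<in> parcs G"; cases "(w, x) \<in> parcs G";
      cases "(v, y) \<in> parcs G"; cases "(w, y) \<in> parcs G"; simp)

lemma toggled_sym: "(x, y) \<in> toggled G v w \<longleftrightarrow> (y, x) \<in> toggled G v w"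
proof -
  have "(toggled G v w)\<inverse> = toggled G v w"
    unfolding toggled_def Let_def by (simp only: converse_Un converse_converse Un_ac)
  then show ?thesis by (metis converse_iff)
qed

lemma toggled_irrefl: "(x, x) \<notin> toggled G v w"
  by (auto simp: toggled_def Let_def)

lemma toggled_subset: "toggled G v w \<subseteq> (nbhd G v \<union> nbhd G w) \<times> (nbhd G v \<union> nbhd G w)"
  unfolding toggled_def Let_def by (intro Un_least; auto)

lemma pair_graph_pivot:
  assumes G: "pair_graph G" and vw: "(v, w) \<in> parcs G"
  shows "pair_graph (pivot G v w)"
proof -
  have g: "finite (pverts G)" "parcs G \<subseteq> pverts G \<times> pverts G" "sym (parcs G)" "irrefl (parcs G)"
    using G by (auto simp: pair_graph_iff)
  have vV: "v \<in> pverts G" "w \<in> pverts G" using g vw by auto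
  let ?s = "Transposition.transpose v w"
  have s: "?s x \<in> pverts G \<longleftrightarrow> x \<in> pverts G" for x
    using vV by (auto simp: Transposition.transpose_def)
  have "nbhd G v \<union> nbhd G w \<subseteq> pverts G" using g(2) by (auto simp: nbhd_def)
  then have "toggled G v w \<subseteq> pverts G \<times> pverts G" using toggled_subset[of G v w] by blast
  then have "?s x \<in> pverts G \<and> ?s y \<in> pverts G" if "(x, y) \<in> parcs (pivot G v w)" for x y
    using that g(2) unfolding parcs_pivot_iff by blast
  then have "parcs (pivot G v w) \<subseteq> pverts G \<times> pverts G" unfolding s by auto
  moreover have "sym (parcs (pivot G v w))"
    unfolding sym_def parcs_pivot_iff using g(3) toggled_sym[of _ _ G v w] by (metis symD)
  moreover have "irrefl (parcs (pivot G v w))"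
    unfolding irrefl_def parcs_pivot_iff using g(4) by (simp add: toggled_irrefl irrefl_def)
  ultimately show ?thesis using g(1) by (simp add: pair_graph_iff)
qed

lemma adj_pivot:
  assumes G: "pair_graph G" and x: "x \<noteq> v" "x \<noteq> w" and y: "y \<noteq> v" "y \<noteq> w"
  shows "adj (pivot G v w) x y = adj G x y + adj G x v * adj G w y + adj G x w * adj G v y"
proof -
  have sym: "(x, v) \<in> parcs G \<longleftrightarrow> (v, x) \<in> parcs G" "(x, w) \<in> parcs G \<longleftrightarrow> (w, x) \<in> parcs G"
    using G by (auto simp: pair_graph_iff dest: symD)
  have "(x, y) \<in> parcs (pivot G v w) \<longleftrightarrow> ((x, y) \<in> parcs G) \<noteq> ((x, y) \<in> toggled G v w)"
    using x y by (simp add: parcs_pivot_iff transpose_apply_other)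
  then show ?thesis
    unfolding adj_def toggled_iff[OF x y] sym
    by (cases "(v, x) \<in> parcs G"; cases "(w, x) \<in> parcs G";
        cases "(v, y) \<in> parcs G"; cases "(w, y) \<in> parcs G"; simp)
qed

lemma adj_pivot_swapped:
  assumes G: "pair_graph G" and x: "x \<noteq> v" "x \<noteq> w"
  shows "adj (pivot G v w) x w = adj G x v"
proof -
  have "(v, v) \<notin> parcs G" using G by (auto simp: pair_graph_iff irrefl_def)
  then have "(x, v) \<notin> toggled G v w" by (simp add: toggled_def Let_def nbhd_def)
  then show ?thesis using x by (simp add: adj_def parcs_pivot_iff transpose_apply_other)
qed

lemma cut_rank_delete_vertex:
  assumes "X \<subseteq> pverts G - {v}"
  shows "cut_rank (delete_vertex G v) X = rank_on (adj G) X (pverts G - {v} - X)"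
proof -
  have "rank_on (adj (delete_vertex G v)) X (pverts G - {v} - X) = rank_on (adj G) X (pverts G - {v} - X)"
    by (rule rank_on_cong) (use assms in \<open>auto simp: adj_def delete_vertex_def\<close>)
  then show ?thesis by (simp add: cut_rank_eq_rank_on delete_vertex_def)
qed

text \<open>
  After the pivot the entry at x and y is \<open>A x y + A x v * A w y + A x w * A v y\<close>, and the column of w is
  the old column of v. So a dependency c among the rows in X of the new matrix extends uniquely to
  a dependency among the rows in \<open>insert v X\<close> of the old one: the coefficient at v has to be the
  value that cancels column w, where row v has entry 1. The kernels have the same size, and there
  is one more row.
\<close>

lemma cut_rank_delete_pivot_aux:
  assumes G: "pair_graph G" and vw: "(v, w) \<in> parcs G" and X: "X \<subseteq> pverts G - {v}" "w \<notin> X"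
  shows "rank_on (adj G) (insert v X) (pverts G - X) =
    rank_on (adj (pivot G v w)) X (pverts G - {v} - X) + 1"
proof -
  let ?A = "adj G" and ?B = "adj (pivot G v w)" and ?V = "pverts G"
  have g: "finite ?V" "parcs G \<subseteq> ?V \<times> ?V" "sym (parcs G)" "irrefl (parcs G)"
    using G by (auto simp: pair_graph_iff)
  have V: "v \<in> ?V" "w \<in> ?V" "v \<noteq> w" using g vw by (auto simp: irrefl_def)
  have fin: "finite X" using X g by (meson finite_Diff finite_subset)
  have vX: "v \<notin> X" using X by auto
  have A: "?A v w = 1" "?A v v = 0" using vw g(4) by (auto simp: adj_def irrefl_def)
  define s where "s c y = (\<Sum>x\<in>X. c x * ?A x y)" for c y
  have s_upd: "s (c(v := a)) y = s c y" for c a y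
    unfolding s_def using vX by (intro sum.cong) auto
  have s_insert: "(\<Sum>x\<in>insert v X. c x * ?A x y) = c v * ?A v y + s c y" for c y
    using fin vX by (simp add: s_def)
  have Bw: "(\<Sum>x\<in>X. c x * ?B x w) = s c v" for c
    unfolding s_def
  proof (intro sum.cong refl)
    fix x assume "x \<in> X"
    then have "x \<noteq> v" "x \<noteq> w" using X vX by auto
    then show "c x * ?B x w = c x * ?A x v" using adj_pivot_swapped[OF G] by simp
  qed
  have By: "(\<Sum>x\<in>X. c x * ?B x y) = s c y + s c v * ?A w y + s c w * ?A v y"
    if y: "y \<noteq> v" "y \<noteq> w" for c y
  proof -
    have "(\<Sum>x\<in>X. c x * ?B x y) =
        (\<Sum>x\<in>X. c x * ?A x y + c x * ?A x v * ?A w y + c x * ?A x w * ?A v y)"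
    proof (intro sum.cong refl)
      fix x assume "x \<in> X"
      then have x: "x \<noteq> v" "x \<noteq> w" using X vX by auto
      show "c x * ?B x y = c x * ?A x y + c x * ?A x v * ?A w y + c x * ?A x w * ?A v y"
        by (simp only: adj_pivot[OF G x y] distrib_left mult.assoc)
    qed
    then show ?thesis by (simp add: s_def sum.distrib sum_distrib_right)
  qed
  let ?K = "left_kernel ?A (insert v X) (?V - X)" and ?L = "left_kernel ?B X (?V - {v} - X)"
  have "c \<in> ?K \<longleftrightarrow> c \<in> supported (insert v X) \<and> (\<forall>y\<in>?V - X. c v * ?A v y + s c y = 0)" for c
    by (simp add: left_kernel_def s_insert)
  then have K: "c \<in> ?K \<longleftrightarrow> c \<in> supported (insert v X) \<and> s c v = 0 \<and> s c w = c v \<and>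
      (\<forall>y\<in>?V - X - {v, w}. c v * ?A v y + s c y = 0)" for c
    using V X A vX by (auto simp: bit_add_eq_0_iff)
  have L: "c \<in> ?L \<longleftrightarrow> c \<in> supported X \<and> s c v = 0 \<and>
      (\<forall>y\<in>?V - X - {v, w}. s c w * ?A v y + s c y = 0)" for c
  proof -
    have "?V - {v} - X = insert w (?V - X - {v, w})" using V X by auto
    then have "c \<in> ?L \<longleftrightarrow> c \<in> supported X \<and> (\<Sum>x\<in>X. c x * ?B x w) = 0 \<and>
        (\<forall>y\<in>?V - X - {v, w}. (\<Sum>x\<in>X. c x * ?B x y) = 0)"
      unfolding left_kernel_def by simp
    also have "\<dots> \<longleftrightarrow> c \<in> supported X \<and> s c v = 0 \<and>
        (\<forall>y\<in>?V - X - {v, w}. s c w * ?A v y + s c y = 0)"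
      by (intro conj_cong ball_cong refl) (simp_all add: Bw By add.commute)
    finally show ?thesis .
  qed
  have "bij_betw (\<lambda>c. c(v := s c w)) ?L ?K"
  proof (rule bij_betw_byWitness[where f' = "\<lambda>c. c(v := 0)"])
    show "\<forall>c\<in>?L. (c(v := s c w))(v := 0) = c"
      using vX by (auto simp: L supported_def fun_eq_iff)
    show "\<forall>c\<in>?K. (c(v := 0))(v := s (c(v := 0)) w) = c"
      by (auto simp: K s_upd fun_eq_iff)
    show "(\<lambda>c. c(v := s c w)) ` ?L \<subseteq> ?K"
      by (auto simp: K L s_upd supported_def)
    show "(\<lambda>c. c(v := 0)) ` ?K \<subseteq> ?L"
      using vX by (auto simp: K L s_upd supported_def)
  qed
  then have "card ?L = card ?K" by (rule bij_betw_same_card)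
  then show ?thesis using fin vX by (intro rank_on_eq_of_card_left_kernel) auto
qed

text \<open>
  If w lies in X, then it does not lie in the complement of X, and both sides are symmetric under
  complementation.
\<close>

lemma cut_rank_delete_pivot:
  assumes G: "pair_graph G" and vw: "(v, w) \<in> parcs G" and X: "X \<subseteq> pverts G - {v}"
  shows "cut_rank (delete_vertex (pivot G v w) v) X + 1 = rank_on (adj G) (insert v X) (pverts G - X)"
proof -
  let ?V = "pverts G" and ?P = "pivot G v w"
  have g: "finite ?V" "sym (parcs G)" "v \<in> ?V" using G vw by (auto simp: pair_graph_iff)
  have eq: "cut_rank (delete_vertex ?P v) X = rank_on (adj ?P) X (?V - {v} - X)"
    if "X \<subseteq> ?V - {v}" for X
    using cut_rank_delete_vertex[of X ?P v] that by simp
  show ?thesis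
  proof (cases "w \<in> X")
    case False
    then show ?thesis using cut_rank_delete_pivot_aux[OF G vw X] eq[OF X] by simp
  next
    case True
    let ?Y = "?V - {v} - X"
    have P: "pair_graph (delete_vertex ?P v)"
      by (intro pair_graph_delete_vertex pair_graph_pivot G vw)
    interpret d: connectivity "?V - {v}" "cut_rank (delete_vertex ?P v)"
      using connectivity_cut_rank[OF P] by (simp add: delete_vertex_def)
    have Y: "?Y \<subseteq> ?V - {v}" "w \<notin> ?Y" using True by auto
    have "cut_rank (delete_vertex ?P v) X + 1 = cut_rank (delete_vertex ?P v) ?Y + 1"
      using d.symmetric[OF X] by simp
    also have "\<dots> = rank_on (adj G) (insert v ?Y) (?V - ?Y)"
      using cut_rank_delete_pivot_aux[OF G vw Y] eq[OF Y(1)] by simp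
    also have "\<dots> = rank_on (adj G) (?V - ?Y) (insert v ?Y)"
      using g by (intro rank_on_symmetric adj_symmetric) auto
    also have "?V - ?Y = insert v X" using X g by auto
    also have "insert v ?Y = ?V - X" using X g by auto
    finally show ?thesis .
  qed
qed

lemma reduction_delete_vertex:
  assumes G: "pair_graph G" and v: "v \<in> pverts G"
  shows "reduction (pverts G) (cut_rank G) v (cut_rank (delete_vertex G v))"
  unfolding reduction_def
proof (intro conjI allI impI)
  let ?V = "pverts G"
  have fin: "finite X" if "X \<subseteq> ?V - {v}" for X
    using that G by (auto simp: pair_graph_iff intro: finite_subset)
  show "connectivity (?V - {v}) (cut_rank (delete_vertex G v))"
    using connectivity_cut_rank[OF pair_graph_delete_vertex[OF G, of v]] by (simp add: delete_vertex_def)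
  show "cut_rank (delete_vertex G v) X \<le> cut_rank G X" if X: "X \<subseteq> ?V - {v}" for X
    unfolding cut_rank_delete_vertex[OF X] unfolding cut_rank_eq_rank_on
    using fin[OF X] by (rule rank_on_mono_columns) auto
  show "cut_rank G X + cut_rank (delete_vertex G v) Z \<le> cut_rank (delete_vertex G v) X + cut_rank G Z"
    if XZ: "X \<subseteq> Z" and Z: "Z \<subseteq> ?V - {v}" for X Z
  proof -
    have X: "X \<subseteq> ?V - {v}" using XZ Z by auto
    have "rank_on (adj G) (X \<union> Z) ((?V - {v} - X) \<inter> (?V - Z)) +
        rank_on (adj G) (X \<inter> Z) ((?V - {v} - X) \<union> (?V - Z))
      \<le> rank_on (adj G) X (?V - {v} - X) + rank_on (adj G) Z (?V - Z)"
      using fin X Z by (intro rank_on_submodular) auto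
    moreover have "X \<union> Z = Z" "X \<inter> Z = X" "(?V - {v} - X) \<inter> (?V - Z) = ?V - {v} - Z"
      "(?V - {v} - X) \<union> (?V - Z) = ?V - X"
      using XZ Z v by auto
    ultimately show ?thesis
      unfolding cut_rank_delete_vertex[OF X] cut_rank_delete_vertex[OF Z]
      unfolding cut_rank_eq_rank_on by simp
  qed
qed

lemma reduction_delete_pivot:
  assumes G: "pair_graph G" and vw: "(v, w) \<in> parcs G"
  shows "reduction (pverts G) (cut_rank G) v (cut_rank (delete_vertex (pivot G v w) v))"
  unfolding reduction_def
proof (intro conjI allI impI)
  let ?V = "pverts G" and ?h = "cut_rank (delete_vertex (pivot G v w) v)"
  note h = cut_rank_delete_pivot[OF G vw]
  have v: "v \<in> ?V" using G vw by (auto simp: pair_graph_iff)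
  have fin: "finite X" if "X \<subseteq> ?V - {v}" for X
    using that G by (auto simp: pair_graph_iff intro: finite_subset)
  have "pair_graph (delete_vertex (pivot G v w) v)"
    by (intro pair_graph_delete_vertex pair_graph_pivot G vw)
  then show "connectivity (?V - {v}) ?h"
    using connectivity_cut_rank by (fastforce simp: delete_vertex_def)
  show "?h X \<le> cut_rank G X" if X: "X \<subseteq> ?V - {v}" for X
    using h[OF X] rank_on_insert_le[OF fin[OF X], of "adj G" v "?V - X"]
    by (simp add: cut_rank_eq_rank_on[of G])
  show "cut_rank G X + ?h Z \<le> ?h X + cut_rank G Z" if XZ: "X \<subseteq> Z" and Z: "Z \<subseteq> ?V - {v}" for X Z
  proof -
    have X: "X \<subseteq> ?V - {v}" using XZ Z by auto
    have "rank_on (adj G) (insert v X \<union> Z) ((?V - X) \<inter> (?V - Z)) +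
        rank_on (adj G) (insert v X \<inter> Z) ((?V - X) \<union> (?V - Z))
      \<le> rank_on (adj G) (insert v X) (?V - X) + rank_on (adj G) Z (?V - Z)"
      using fin X Z by (intro rank_on_submodular) auto
    moreover have "insert v X \<union> Z = insert v Z" "insert v X \<inter> Z = X"
      "(?V - X) \<inter> (?V - Z) = ?V - Z" "(?V - X) \<union> (?V - Z) = ?V - X"
      using XZ Z by auto
    ultimately show ?thesis using h[OF X] h[OF Z] by (simp add: cut_rank_eq_rank_on[of G])
  qed
qed

lemma reduction_pair_delete_pivot:
  assumes G: "pair_graph G" and vw: "(v, w) \<in> parcs G"
  shows "reduction_pair (pverts G) (cut_rank G) v
    (cut_rank (delete_vertex G v)) (cut_rank (delete_vertex (pivot G v w) v))"
  unfolding reduction_pair_def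
proof (intro conjI allI impI)
  let ?V = "pverts G"
  have v: "v \<in> ?V" using G vw by (auto simp: pair_graph_iff)
  show "reduction ?V (cut_rank G) v (cut_rank (delete_vertex G v))"
    using G v by (rule reduction_delete_vertex)
  show "reduction ?V (cut_rank G) v (cut_rank (delete_vertex (pivot G v w) v))"
    using G vw by (rule reduction_delete_pivot)
  fix X Y assume XY: "X \<subseteq> ?V - {v}" "Y \<subseteq> ?V - {v}"
  have fin: "finite X" "finite Y" using XY G by (auto simp: pair_graph_iff intro: finite_subset)
  then have "rank_on (adj G) (X \<union> insert v Y) ((?V - {v} - X) \<inter> (?V - Y)) +
      rank_on (adj G) (X \<inter> insert v Y) ((?V - {v} - X) \<union> (?V - Y))
    \<le> rank_on (adj G) X (?V - {v} - X) + rank_on (adj G) (insert v Y) (?V - Y)"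
    by (intro rank_on_submodular) auto
  moreover have "X \<union> insert v Y = insert v (X \<union> Y)" "X \<inter> insert v Y = X \<inter> Y"
    "(?V - {v} - X) \<inter> (?V - Y) = ?V - insert v (X \<union> Y)"
    "(?V - {v} - X) \<union> (?V - Y) = ?V - X \<inter> Y"
    using XY v by auto
  ultimately show "cut_rank G (X \<inter> Y) + cut_rank G (insert v (X \<union> Y))
      \<le> cut_rank (delete_vertex G v) X + cut_rank (delete_vertex (pivot G v w) v) Y + 1"
    using cut_rank_delete_pivot[OF G vw XY(2)] cut_rank_delete_vertex[OF XY(1)]
    by (simp add: cut_rank_eq_rank_on[of G])
qed

text \<open>
  At an isolated vertex there is nothing to pivot on, but deleting it loses so little that
  deletion can be paired with itself.
\<close>

lemma reduction_pair_isolated: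
  assumes G: "pair_graph G" and v: "v \<in> pverts G" and isolated: "\<And>w. (v, w) \<notin> parcs G"
  shows "reduction_pair (pverts G) (cut_rank G) v
    (cut_rank (delete_vertex G v)) (cut_rank (delete_vertex G v))"
  unfolding reduction_pair_def
proof (intro conjI allI impI)
  let ?V = "pverts G" and ?g = "cut_rank (delete_vertex G v)"
  note red = reduction_delete_vertex[OF G v]
  show "reduction ?V (cut_rank G) v ?g" "reduction ?V (cut_rank G) v ?g" using red by auto
  interpret g: connectivity "?V - {v}" ?g using reductionD(1)[OF red] .
  fix X Y assume XY: "X \<subseteq> ?V - {v}" "Y \<subseteq> ?V - {v}"
  have "adj G x v = 0" for x using isolated G by (auto simp: adj_def pair_graph_iff dest: symD)
  then have "row_on (adj G) (?V - X \<inter> Y) x = row_on (adj G) (?V - {v} - X \<inter> Y) x" for x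
    by (auto simp: row_on_def)
  then have "cut_rank G (X \<inter> Y) = ?g (X \<inter> Y)"
    using cut_rank_delete_vertex[of "X \<inter> Y" G v] XY
    by (simp add: le_infI1 cut_rank_eq_rank_on[of G] rank_on_def)
  moreover have "finite (X \<union> Y)" using XY G by (auto simp: pair_graph_iff intro: finite_subset)
  then have "cut_rank G (insert v (X \<union> Y)) \<le> ?g (X \<union> Y) + 1"
  proof -
    have "?V - insert v (X \<union> Y) = ?V - {v} - (X \<union> Y)" by auto
    moreover have "?g (X \<union> Y) = rank_on (adj G) (X \<union> Y) (?V - {v} - (X \<union> Y))"
      using XY by (intro cut_rank_delete_vertex) auto
    ultimately show ?thesis
      unfolding cut_rank_eq_rank_on[of G]
      using rank_on_insert_le[OF \<open>finite (X \<union> Y)\<close>, of "adj G" v "?V - {v} - (X \<union> Y)"] by simp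
  qed
  ultimately show "cut_rank G (X \<inter> Y) + cut_rank G (insert v (X \<union> Y)) \<le> ?g X + ?g Y + 1"
    using g.submodular[OF XY] by linarith
qed

text \<open>
  Deleting v from this graph gives the second reduction. For isolated v the graph is G itself, as in
  \<open>reduction_pair_isolated\<close>.
\<close>

definition pivoted :: "'a pair_pre_digraph \<Rightarrow> 'a \<Rightarrow> 'a pair_pre_digraph" where
  "pivoted G v = (if \<exists>w. (v, w) \<in> parcs G then pivot G v (SOME w. (v, w) \<in> parcs G) else G)"

lemma pivoted_cases:
  obtains (edge) w where "(v, w) \<in> parcs G" "pivoted G v = pivot G v w"
  | (isolated) "\<And>w. (v, w) \<notin> parcs G" "pivoted G v = G"
proof (cases "\<exists>w. (v, w) \<in> parcs G")
  case True
  then have "(v, SOME w. (v, w) \<in> parcs G) \<in> parcs G" by (rule someI_ex)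
  then show ?thesis using edge True by (simp add: pivoted_def)
qed (use isolated in \<open>auto simp: pivoted_def\<close>)

lemma reduction_pair_pivoted:
  assumes G: "pair_graph G" and v: "v \<in> pverts G"
  shows "reduction_pair (pverts G) (cut_rank G) v
    (cut_rank (delete_vertex G v)) (cut_rank (delete_vertex (pivoted G v) v))"
  using reduction_pair_delete_pivot[OF G] reduction_pair_isolated[OF G v]
  by (cases rule: pivoted_cases[of v G]) auto

lemma proper_pivot_minor_delete_vertex:
  assumes "pair_graph K" "pivot_equivalent K G" "pverts K = pverts G" "v \<in> pverts G"
  shows "proper_pivot_minor (delete_vertex K v) G"
proof -
  have "finite (pverts G)" using assms by (auto simp: pair_graph_iff)
  then have "card (pverts G - {v}) < card (pverts G)" using assms(4) by (rule card_Diff1_less)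
  then show ?thesis
    using assms induced_subgraph_delete_vertex[OF assms(1), of v]
    by (auto simp: proper_pivot_minor_def pivot_minor_def delete_vertex_def)
qed

lemma pivoted_properties:
  assumes "pair_graph G"
  shows "pair_graph (pivoted G v)" "pivot_equivalent (pivoted G v) G" "pverts (pivoted G v) = pverts G"
proof -
  have "pair_graph (pivoted G v) \<and> pivot_equivalent (pivoted G v) G \<and> pverts (pivoted G v) = pverts G"
  proof (cases rule: pivoted_cases[of v G])
    case (edge w)
    have "pivot_step G (pivot G v w)" using edge(1) by (auto simp: pivot_step_def)
    then have "pivot_equivalent (pivot G v w) G"
      unfolding pivot_equivalent_def by (rule r_into_rtranclp)
    then show ?thesis using edge(2) pair_graph_pivot[OF assms edge(1)] by simp
  next
    case isolated
    then show ?thesis using assms by (simp add: pivot_equivalent_def)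
  qed
  then show "pair_graph (pivoted G v)" "pivot_equivalent (pivoted G v) G"
    "pverts (pivoted G v) = pverts G" by auto
qed

theorem theorem7p5:
  fixes G :: "'a pair_pre_digraph" and k :: nat
  assumes "k \<ge> 2"
    and "pair_graph G"
    and "rank_width G > k"
    and "\<And>H. proper_pivot_minor H G \<Longrightarrow> rank_width H \<le> k"
  shows "real (card (pverts G)) \<le> ((7 / 12) * 6 ^ (k + 1) - 1) / 5"
proof -
  let ?V = "pverts G"
  have card: "2 \<le> card ?V" using assms(3) by (simp add: rank_width_def split: if_splits)
  have reduct: "branched (cut_rank (delete_vertex K v)) k (?V - {v})"
    if "pair_graph K" "pivot_equivalent K G" "pverts K = ?V" "v \<in> ?V" "?V - {v} \<noteq> {}" for K v
    using branched_of_rank_width[OF pair_graph_delete_vertex[OF that(1), of v]]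
      assms(4)[OF proper_pivot_minor_delete_vertex[OF that(1-4)]] that(3,5)
    by (simp add: delete_vertex_def)
  interpret minimal_obstruction ?V "cut_rank G" k "\<lambda>v. cut_rank (delete_vertex G v)"
    "\<lambda>v. cut_rank (delete_vertex (pivoted G v) v)"
  proof (intro minimal_obstruction.intro minimal_obstruction_axioms.intro conjI)
    show "connectivity ?V (cut_rank G)" using assms(2) by (rule connectivity_cut_rank)
    show "reduction_pair ?V (cut_rank G) v (cut_rank (delete_vertex G v))
        (cut_rank (delete_vertex (pivoted G v) v))" if "v \<in> ?V" for v
      using assms(2) that by (rule reduction_pair_pivoted)
    show "branched (cut_rank (delete_vertex G v)) k (?V - {v})"
      "branched (cut_rank (delete_vertex (pivoted G v) v)) k (?V - {v})"
      if "v \<in> ?V" "?V - {v} \<noteq> {}" for v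
      using that assms(2) pivoted_properties[OF assms(2)]
      by (intro reduct; simp add: pivot_equivalent_def)+
    show "\<not> branched (cut_rank G) k ?V"
      using rank_width_le_iff[OF assms(2) card, of k] assms(3) by simp
  qed (use assms(1) in simp)
  have "real (card ?V) \<le> real (6 * cut_bound k + 1)" using card_ground_le by simp
  then show ?thesis using cut_bound_closed_form[OF assms(1)] by simp
qed

end
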